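(* Let $(\Sigma_g,\boldsymbol{\alpha},\boldsymbol{\beta})$ be a Heegaard diagram, with $\boldsymbol{\alpha}=\{\alpha_1,\dots,\alpha_g\}$ and $\boldsymbol{\beta}=\{\beta_1,\dots,\beta_g\}$, let $T_\alpha,T_\beta\subset \mathrm{Sym}_g(\Sigma_g)$ be the associated tori, and let $\bar\iota_\alpha,\bar\iota_\beta\colon T^g\to \mathrm{Sym}_g(\Sigma_g)$ be the associated maps with images $T_\alpha$ and $T_\beta$. Let $x,y\in T_\alpha\cap T_\beta$. Then there is a Whitney disk connecting $x$ and $y$ if and only if the pairs $(\bar\iota_\alpha^{-1}(x),\bar\iota_\beta^{-1}(x))$ and $(\bar\iota_\alpha^{-1}(y),\bar\iota_\beta^{-1}(y))$ are in the same common value class of $\bar\iota_\alpha$ and $\bar\iota_\beta$.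
   Context: A Heegaard diagram $(\Sigma_g,\boldsymbol{\alpha},\boldsymbol{\beta})$ consists of a closed oriented surface $\Sigma_g$ of genus $g$ and two collections $\boldsymbol{\alpha}=\{\alpha_1,\dots,\alpha_g\}$ and $\boldsymbol{\beta}=\{\beta_1,\dots,\beta_g\}$ of simple loops in $\Sigma_g$, the loops within each collection being pairwise disjoint, such that $\Sigma_g-\boldsymbol{\alpha}$ and $\Sigma_g-\boldsymbol{\beta}$ are both punctured spheres. The loops are regarded as parametrized embeddings $\alpha_i,\beta_i\colon S^1\to\Sigma_g$. The symmetric product is $\mathrm{Sym}_g(\Sigma_g)=(\Sigma_g)^g/S_g$, the quotient by the symmetric group permuting coordinates, with quotient map $\pi\colon(\Sigma_g)^g\to\mathrm{Sym}_g(\Sigma_g)$. Put $T_\alpha=\pi(\alpha_1\times\cdots\times\alpha_g)$ and $T_\beta=\pi(\beta_1\times\cdots\times\beta_g)$. Let $T^g=(S^1)^g$ and define $\bar\iota_\alpha(\theta_1,\dots,\theta_g)=\pi(\alpha_1(\theta_1),\dots,\alpha_g(\theta_g))$ and $\bar\iota_\beta(\theta_1,\dots,\theta_g)=\pi(\beta_1(\theta_1),\dots,\beta_g(\theta_g))$. These maps are injective, so for $w\in T_\alpha\cap T_\beta$ the symbols $\bar\iota_\alpha^{-1}(w)$ and $\bar\iota_\beta^{-1}(w)$ denote points of $T^g$. Whitney disk: for $x,y\in T_\alpha\cap T_\beta$, a Whitney disk connecting $x$ and $y$ is a continuous map $\mathbb{D}^2\to\mathrm{Sym}_g(\Sigma_g)$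 from the closed unit disk in $\mathbb{C}$ sending $e_1$ into $T_\alpha$, $e_2$ into $T_\beta$, $-i$ to $x$ and $i$ to $y$, where $e_1,e_2$ are the arcs of $\partial\mathbb{D}^2$ with $\mathrm{Re}\ge 0$ and $\mathrm{Re}\le 0$ respectively. Equivalently, there are a path in $T_\alpha$ from $x$ to $y$ and a path in $T_\beta$ from $x$ to $y$ which are homotopic relative to endpoints in $\mathrm{Sym}_g(\Sigma_g)$. Common value classes: for maps $\varphi,\psi\colon X\to Y$, the set of common value pairs is $\mathrm{CVP}(\varphi,\psi)=\{(u,v)\in X^2\mid \varphi(u)=\psi(v)\}$. Let $p_X\colon\tilde X\to X$ and $p_Y\colon\tilde Y\to Y$ be universal coverings. For liftings $\tilde\varphi,\tilde\psi\colon\tilde X\to\tilde Y$ of $\varphi,\psi$, the common value class of $\varphi$ and $\psi$ determined by $(\tilde\varphi,\tilde\psi)$ is the set $(p_X\times p_X)(\mathrm{CVP}(\tilde\varphi,\tilde\psi))\subset X^2$. Any two such sets are equal or disjoint, and their union over all liftings is $\mathrm{CVP}(\varphi,\psi)$. Two common value pairs are in the same common value class if both lie in $(p_X\times p_X)(\mathrm{CVP}(\tilde\varphi,\tilde\psi))$ for some liftings $\tilde\varphi,\tilde\psi$. Here $X=T^g$, $Y=\mathrm{Sym}_g(\Sigma_g)$, $\varphi=\bar\iota_\alpha$, $\psi=\bar\iota_\beta$. *)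

theory Defs
  imports "HOL-Homology.Homology" "HOL-Combinatorics.Permutations"
begin

section \<open>Closed oriented surfaces and their genus\<close>

text \<open>Second countability is omitted because it follows from compactness.\<close>

definition closed_surface :: "'a topology \<Rightarrow> bool" where
  "closed_surface S \<longleftrightarrow>
     topspace S \<noteq> {} \<and> connected_space S \<and> compact_space S \<and> Hausdorff_space S \<and>
     (\<forall>x\<in>topspace S. \<exists>U. openin S U \<and> x \<in> U \<and>
        subtopology S U homeomorphic_space (euclidean :: (real^2) topology))"

text \<open>An orientation of \<open>S\<close> is a choice \<open>\<mu> x\<close> of a generator of the local homology group
  \<open>H\<^sub>2(S, S - {x}; \<int>)\<close> for every point \<open>x\<close>, which is locally consistent: near each point
  the \<open>\<mu> y\<close> are the restrictions of one class in \<open>H\<^sub>2(S, S - U; \<int>)\<close>.\<close>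

definition surface_orientation :: "'a topology \<Rightarrow> ('a \<Rightarrow> 'a chain set) \<Rightarrow> bool" where
  "surface_orientation S \<mu> \<longleftrightarrow>
     (\<forall>x\<in>topspace S.
        \<mu> x \<in> carrier (relative_homology_group 2 S (topspace S - {x})) \<and>
        subgroup_generated (relative_homology_group 2 S (topspace S - {x})) {\<mu> x} =
          relative_homology_group 2 S (topspace S - {x})) \<and>
     (\<forall>x\<in>topspace S. \<exists>U. openin S U \<and> x \<in> U \<and>
        (\<exists>c \<in> carrier (relative_homology_group 2 S (topspace S - U)).
           \<forall>y\<in>U. hom_induced 2 S (topspace S - U) S (topspace S - {y}) id c = \<mu> y))"

text \<open>The genus is half the first Betti number: \<open>H\<^sub>1(S; \<int>)\<close> is free abelian of rank \<open>2g\<close>.\<close>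

definition closed_oriented_surface :: "nat \<Rightarrow> 'a topology \<Rightarrow> ('a \<Rightarrow> 'a chain set) \<Rightarrow> bool" where
  "closed_oriented_surface g S \<mu> \<longleftrightarrow>
     closed_surface S \<and> surface_orientation S \<mu> \<and>
     homology_group 1 S \<cong> free_Abelian_group {..<2 * g}"

section \<open>Heegaard diagrams\<close>

abbreviation circle :: "complex topology" where
  "circle \<equiv> top_of_set (sphere 0 1)"

definition punctured_sphere :: "'a topology \<Rightarrow> bool" where
  "punctured_sphere X \<longleftrightarrow>
     (\<exists>P. finite P \<and> P \<subseteq> sphere (0::real^3) 1 \<and>
        X homeomorphic_space top_of_set (sphere (0::real^3) 1 - P))"

text \<open>The loops are indexed by \<open>{..<g}\<close>; the values of \<open>\<gamma> i\<close> for \<open>i \<ge> g\<close> are irrelevant.\<close>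

definition attaching_loops :: "nat \<Rightarrow> 'a topology \<Rightarrow> (nat \<Rightarrow> complex \<Rightarrow> 'a) \<Rightarrow> bool" where
  "attaching_loops g S \<gamma> \<longleftrightarrow>
     (\<forall>i<g. embedding_map circle S (\<gamma> i)) \<and>
     (\<forall>i<g. \<forall>j<g. i \<noteq> j \<longrightarrow> disjnt (\<gamma> i ` topspace circle) (\<gamma> j ` topspace circle)) \<and>
     punctured_sphere (subtopology S (topspace S - (\<Union>i<g. \<gamma> i ` topspace circle)))"

definition heegaard_diagram ::
    "nat \<Rightarrow> 'a topology \<Rightarrow> ('a \<Rightarrow> 'a chain set) \<Rightarrow>
     (nat \<Rightarrow> complex \<Rightarrow> 'a) \<Rightarrow> (nat \<Rightarrow> complex \<Rightarrow> 'a) \<Rightarrow> bool" where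
  "heegaard_diagram g S \<mu> \<alpha> \<beta> \<longleftrightarrow>
     closed_oriented_surface g S \<mu> \<and> attaching_loops g S \<alpha> \<and> attaching_loops g S \<beta>"

section \<open>Symmetric products and the tori\<close>

text \<open>Points of the symmetric product are the orbits of the symmetric group on \<open>{..<g}\<close>
  acting on extensional \<open>g\<close>-tuples.\<close>

definition sym_proj :: "nat \<Rightarrow> (nat \<Rightarrow> 'a) \<Rightarrow> (nat \<Rightarrow> 'a) set" where
  "sym_proj g f = {f \<circ> \<sigma> | \<sigma>. \<sigma> permutes {..<g}}"

definition sym_product :: "nat \<Rightarrow> 'a topology \<Rightarrow> (nat \<Rightarrow> 'a) set topology" where
  "sym_product g S = topology (\<lambda>U.
     U \<subseteq> sym_proj g ` topspace (product_topology (\<lambda>_. S) {..<g}) \<and>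
     openin (product_topology (\<lambda>_. S) {..<g})
       {f \<in> topspace (product_topology (\<lambda>_. S) {..<g}). sym_proj g f \<in> U})"

definition torus :: "nat \<Rightarrow> (nat \<Rightarrow> complex) topology" where
  "torus g = product_topology (\<lambda>_. circle) {..<g}"

definition sym_torus :: "nat \<Rightarrow> (nat \<Rightarrow> complex \<Rightarrow> 'a) \<Rightarrow> (nat \<Rightarrow> 'a) set set" where
  "sym_torus g \<gamma> = sym_proj g ` (\<Pi>\<^sub>E i\<in>{..<g}. \<gamma> i ` topspace circle)"

definition torus_map :: "nat \<Rightarrow> (nat \<Rightarrow> complex \<Rightarrow> 'a) \<Rightarrow> (nat \<Rightarrow> complex) \<Rightarrow> (nat \<Rightarrow> 'a) set" where
  "torus_map g \<gamma> \<theta> = sym_proj g (\<lambda>i\<in>{..<g}. \<gamma> i (\<theta> i))"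

definition torus_map_inv :: "nat \<Rightarrow> (nat \<Rightarrow> complex \<Rightarrow> 'a) \<Rightarrow> (nat \<Rightarrow> 'a) set \<Rightarrow> nat \<Rightarrow> complex" where
  "torus_map_inv g \<gamma> = inv_into (topspace (torus g)) (torus_map g \<gamma>)"

lemma istopology_sym_product:
  "istopology (\<lambda>U. U \<subseteq> sym_proj g ` topspace X \<and>
     openin X {f \<in> topspace X. sym_proj g f \<in> U})"
proof -
  have 1: "{f \<in> topspace X. sym_proj g f \<in> U \<inter> V} =
      {f \<in> topspace X. sym_proj g f \<in> U} \<inter> {f \<in> topspace X. sym_proj g f \<in> V}" for U V
    by auto
  have 2: "{f \<in> topspace X. sym_proj g f \<in> \<Union>\<K>} =
      (\<Union>U\<in>\<K>. {f \<in> topspace X. sym_proj g f \<in> U})" for \<K>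
    by auto
  show ?thesis
    unfolding istopology_def 1 2 by (auto intro: openin_Int openin_Union)
qed

lemma openin_sym_product:
  "openin (sym_product g S) U \<longleftrightarrow>
     U \<subseteq> sym_proj g ` topspace (product_topology (\<lambda>_. S) {..<g}) \<and>
     openin (product_topology (\<lambda>_. S) {..<g})
       {f \<in> topspace (product_topology (\<lambda>_. S) {..<g}). sym_proj g f \<in> U}"
  unfolding sym_product_def topology_inverse'[OF istopology_sym_product] ..

lemma topspace_sym_product:
  "topspace (sym_product g S) = sym_proj g ` topspace (product_topology (\<lambda>_. S) {..<g})"
proof
  show "topspace (sym_product g S) \<subseteq> sym_proj g ` topspace (product_topology (\<lambda>_. S) {..<g})"
    using openin_sym_product openin_topspace by blast
  have "{f \<in> topspace (product_topology (\<lambda>_. S) {..<g}). sym_proj g f \<in>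
      sym_proj g ` topspace (product_topology (\<lambda>_. S) {..<g})}
      = topspace (product_topology (\<lambda>_. S) {..<g})"
    by blast
  then have "openin (sym_product g S) (sym_proj g ` topspace (product_topology (\<lambda>_. S) {..<g}))"
    unfolding openin_sym_product by (metis openin_topspace order_refl)
  then show "sym_proj g ` topspace (product_topology (\<lambda>_. S) {..<g}) \<subseteq> topspace (sym_product g S)"
    by (rule openin_subset)
qed

lemma quotient_map_sym_proj:
  "quotient_map (product_topology (\<lambda>_. S) {..<g}) (sym_product g S) (sym_proj g)"
  unfolding quotient_map_def topspace_sym_product openin_sym_product by blast

lemma torus_map_image: "torus_map g \<gamma> ` topspace (torus g) = sym_torus g \<gamma>"
proof -
  have "(\<lambda>\<theta>. \<lambda>i\<in>{..<g}. \<gamma> i (\<theta> i)) ` topspace (torus g) = (\<Pi>\<^sub>E i\<in>{..<g}. \<gamma> i ` topspace circle)"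
  proof (intro equalityI subsetI)
    fix f assume f: "f \<in> (\<Pi>\<^sub>E i\<in>{..<g}. \<gamma> i ` topspace circle)"
    then have "\<forall>i\<in>{..<g}. \<exists>z\<in>topspace circle. f i = \<gamma> i z"
      by (auto simp: PiE_iff)
    then obtain \<theta> where \<theta>: "\<forall>i\<in>{..<g}. \<theta> i \<in> topspace circle \<and> f i = \<gamma> i (\<theta> i)"
      by metis
    have "f = (\<lambda>i\<in>{..<g}. \<gamma> i (restrict \<theta> {..<g} i))"
      using f \<theta> by (auto simp: PiE_iff extensional_def)
    moreover have "restrict \<theta> {..<g} \<in> topspace (torus g)"
      using \<theta> by (auto simp: torus_def)
    ultimately show "f \<in> (\<lambda>\<theta>. \<lambda>i\<in>{..<g}. \<gamma> i (\<theta> i)) ` topspace (torus g)"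
      by blast
  qed (auto simp: torus_def PiE_iff)
  then show ?thesis
    unfolding sym_torus_def torus_map_def by (metis image_image)
qed

lemma torus_map_inj:
  assumes "attaching_loops g S \<gamma>"
  shows "inj_on (torus_map g \<gamma>) (topspace (torus g))"
proof (rule inj_onI)
  fix \<theta> \<eta> assume \<theta>: "\<theta> \<in> topspace (torus g)" and \<eta>: "\<eta> \<in> topspace (torus g)"
    and eq: "torus_map g \<gamma> \<theta> = torus_map g \<gamma> \<eta>"
  have "(\<lambda>i\<in>{..<g}. \<gamma> i (\<theta> i)) \<circ> id \<in> torus_map g \<gamma> \<theta>"
    unfolding torus_map_def sym_proj_def using permutes_id by blast
  then have "(\<lambda>i\<in>{..<g}. \<gamma> i (\<theta> i)) \<in> torus_map g \<gamma> \<eta>"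
    by (simp add: eq)
  then obtain \<sigma> where \<sigma>: "\<sigma> permutes {..<g}"
    and e: "(\<lambda>i\<in>{..<g}. \<gamma> i (\<theta> i)) = (\<lambda>i\<in>{..<g}. \<gamma> i (\<eta> i)) \<circ> \<sigma>"
    unfolding torus_map_def sym_proj_def by blast
  have "\<theta> i = \<eta> i" if i: "i < g" for i
  proof -
    have s: "\<sigma> i < g" using \<sigma> i permutes_in_image by fastforce
    have v: "\<gamma> i (\<theta> i) = \<gamma> (\<sigma> i) (\<eta> (\<sigma> i))"
      using fun_cong[OF e, of i] i s by simp
    have c: "\<theta> i \<in> topspace circle" "\<eta> (\<sigma> i) \<in> topspace circle"
      using \<theta> \<eta> i s unfolding torus_def topspace_product_topology PiE_iff by auto
    then have "\<not> disjnt (\<gamma> i ` topspace circle) (\<gamma> (\<sigma> i) ` topspace circle)"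
      using v unfolding disjnt_iff by (metis imageI)
    then have "\<sigma> i = i" using assms i s unfolding attaching_loops_def by metis
    moreover have "inj_on (\<gamma> i) (topspace circle)"
      using assms i unfolding attaching_loops_def embedding_map_def
      by (metis homeomorphic_imp_injective_map)
    ultimately show ?thesis using v c by (metis inj_onD)
  qed
  then show "\<theta> = \<eta>"
    using \<theta> \<eta> unfolding torus_def topspace_product_topology
    by (auto intro: PiE_ext)
qed

section \<open>Whitney disks\<close>

definition whitney_disk ::
    "nat \<Rightarrow> 'a topology \<Rightarrow> (nat \<Rightarrow> complex \<Rightarrow> 'a) \<Rightarrow> (nat \<Rightarrow> complex \<Rightarrow> 'a) \<Rightarrow>
     (nat \<Rightarrow> 'a) set \<Rightarrow> (nat \<Rightarrow> 'a) set \<Rightarrow> (complex \<Rightarrow> (nat \<Rightarrow> 'a) set) \<Rightarrow> bool" where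
  "whitney_disk g S \<alpha> \<beta> x y u \<longleftrightarrow>
     continuous_map (top_of_set (cball (0::complex) 1)) (sym_product g S) u \<and>
     u ` {z \<in> sphere 0 1. Re z \<ge> 0} \<subseteq> sym_torus g \<alpha> \<and>
     u ` {z \<in> sphere 0 1. Re z \<le> 0} \<subseteq> sym_torus g \<beta> \<and>
     u (- \<i>) = x \<and> u \<i> = y"

section \<open>Universal coverings and common value classes\<close>

text \<open>The library has covering spaces and simple connectedness only for subsets of
  type-class topological spaces; these are the versions for abstract topologies.\<close>

definition covering_map :: "'a topology \<Rightarrow> 'b topology \<Rightarrow> ('a \<Rightarrow> 'b) \<Rightarrow> bool" where
  "covering_map E X p \<longleftrightarrow>
     continuous_map E X p \<and> p ` topspace E = topspace X \<and>
     (\<forall>x\<in>topspace X. \<exists>T. x \<in> T \<and> openin X T \<and>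
        (\<exists>\<V>. \<Union>\<V> = topspace E \<inter> p -` T \<and>
             (\<forall>V\<in>\<V>. openin E V) \<and> pairwise disjnt \<V> \<and>
             (\<forall>V\<in>\<V>. homeomorphic_map (subtopology E V) (subtopology X T) p)))"

definition simply_connected_space :: "'a topology \<Rightarrow> bool" where
  "simply_connected_space X \<longleftrightarrow>
     path_connected_space X \<and>
     (\<forall>c. pathin X c \<and> c 0 = c 1 \<longrightarrow>
        homotopic_with (\<lambda>q. q 0 = c 0 \<and> q 1 = c 0) (top_of_set {0..1}) X c (\<lambda>_. c 0))"

definition universal_covering :: "'a topology \<Rightarrow> 'b topology \<Rightarrow> ('a \<Rightarrow> 'b) \<Rightarrow> bool" where
  "universal_covering E X p \<longleftrightarrow> covering_map E X p \<and> simply_connected_space E"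

definition is_lifting ::
    "'c topology \<Rightarrow> ('c \<Rightarrow> 'a) \<Rightarrow> 'd topology \<Rightarrow> ('d \<Rightarrow> 'b) \<Rightarrow> ('a \<Rightarrow> 'b) \<Rightarrow> ('c \<Rightarrow> 'd) \<Rightarrow> bool" where
  "is_lifting X' pX Y' pY \<phi> \<phi>' \<longleftrightarrow>
     continuous_map X' Y' \<phi>' \<and> (\<forall>u\<in>topspace X'. pY (\<phi>' u) = \<phi> (pX u))"

definition CVP :: "'a topology \<Rightarrow> ('a \<Rightarrow> 'b) \<Rightarrow> ('a \<Rightarrow> 'b) \<Rightarrow> ('a \<times> 'a) set" where
  "CVP X \<phi> \<psi> = {(u, v). u \<in> topspace X \<and> v \<in> topspace X \<and> \<phi> u = \<psi> v}"

definition common_value_class ::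
    "'c topology \<Rightarrow> ('c \<Rightarrow> 'a) \<Rightarrow> ('c \<Rightarrow> 'd) \<Rightarrow> ('c \<Rightarrow> 'd) \<Rightarrow> ('a \<times> 'a) set" where
  "common_value_class X' pX \<phi>' \<psi>' = map_prod pX pX ` CVP X' \<phi>' \<psi>'"

definition same_common_value_class ::
    "'c topology \<Rightarrow> ('c \<Rightarrow> 'a) \<Rightarrow> 'd topology \<Rightarrow> ('d \<Rightarrow> 'b) \<Rightarrow> ('a \<Rightarrow> 'b) \<Rightarrow> ('a \<Rightarrow> 'b) \<Rightarrow>
     'a \<times> 'a \<Rightarrow> 'a \<times> 'a \<Rightarrow> bool" where
  "same_common_value_class X' pX Y' pY \<phi> \<psi> P Q \<longleftrightarrow>
     (\<exists>\<phi>' \<psi>'. is_lifting X' pX Y' pY \<phi> \<phi>' \<and> is_lifting X' pX Y' pY \<psi> \<psi>' \<and>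
        P \<in> common_value_class X' pX \<phi>' \<psi>' \<and> Q \<in> common_value_class X' pX \<phi>' \<psi>')"

end

theory Submission
  imports Defs "HOL-Analysis.Retracts"
begin

text \<open>Paths in \<open>X'\<close> between the two pairs are carried by liftings \<open>\<phi>'\<close>, \<open>\<psi>'\<close> to two paths in \<open>Y'\<close>
  with the same endpoints. These are homotopic since \<open>Y'\<close> is simply connected, and the projected
  homotopy is a Whitney disk. Conversely, the tori are embedded, so the boundary arcs of a Whitney disk
  come from paths in the torus. Choose lifts of these to \<open>X'\<close>, and liftings \<open>\<phi>'\<close>, \<open>\<psi>'\<close> that
  agree at the initial points; the disk is a homotopy between the two arcs, so it lifts to \<open>Y'\<close> and
  forces \<open>\<phi>'\<close>, \<open>\<psi>'\<close> to agree at the final points as well.\<close>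

section \<open>Lifting through coverings of abstract topologies\<close>

lemma covering_map_continuous: "covering_map E X p \<Longrightarrow> continuous_map E X p"
  by (simp add: covering_map_def)

lemma covering_map_sheet:
  assumes "covering_map E X p" "e \<in> topspace E"
  obtains T V h where "openin X T" "p e \<in> T" "openin E V" "e \<in> V"
    "homeomorphic_maps (subtopology E V) (subtopology X T) p h"
proof -
  have "p e \<in> topspace X"
    using assms unfolding covering_map_def by blast
  then obtain T \<V> where T: "p e \<in> T" "openin X T" "\<Union>\<V> = topspace E \<inter> p -` T"
      "\<forall>V\<in>\<V>. openin E V" "\<forall>V\<in>\<V>. homeomorphic_map (subtopology E V) (subtopology X T) p"
    using assms(1) unfolding covering_map_def by meson
  moreover obtain V where "V \<in> \<V>" "e \<in> V"
    using T assms(2) by blast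
  ultimately show ?thesis
    using that unfolding homeomorphic_map_maps by blast
qed

lemma covering_map_locally_injective:
  assumes "covering_map E X p" "e \<in> topspace E"
  obtains V where "openin E V" "e \<in> V" "inj_on p V"
proof -
  obtain T V h where V: "openin E V" "e \<in> V"
      "homeomorphic_maps (subtopology E V) (subtopology X T) p h"
    using covering_map_sheet[OF assms] by metis
  then have "inj_on p (topspace (subtopology E V))"
    by (metis homeomorphic_imp_injective_map homeomorphic_map_maps)
  then have "inj_on p V"
    using openin_subset[OF V(1)] by (simp add: inf_absorb2)
  then show ?thesis using that V by blast
qed

text \<open>Both points lie over one evenly covered set, and \<open>p\<close> is injective on each
  sheet, so they lie on different, hence disjoint, sheets. This separation inside a fibre shows
  later that the set where two lifts differ is open.\<close>

lemma covering_map_separates_fibre: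
  assumes "covering_map E X p" "e1 \<in> topspace E" "e2 \<in> topspace E" "p e1 = p e2" "e1 \<noteq> e2"
  obtains V1 V2 where "openin E V1" "openin E V2" "e1 \<in> V1" "e2 \<in> V2" "disjnt V1 V2"
proof -
  have "p e1 \<in> topspace X"
    using assms unfolding covering_map_def by blast
  then obtain T \<V> where T: "p e1 \<in> T" "\<Union>\<V> = topspace E \<inter> p -` T"
      "\<forall>V\<in>\<V>. openin E V" "pairwise disjnt \<V>"
      "\<forall>V\<in>\<V>. homeomorphic_map (subtopology E V) (subtopology X T) p"
    using assms(1) unfolding covering_map_def by meson
  obtain V1 V2 where V: "V1 \<in> \<V>" "e1 \<in> V1" "V2 \<in> \<V>" "e2 \<in> V2"
    using T assms by (metis IntI UnionE vimageI)
  have "inj_on p (topspace (subtopology E V1))"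
    using T(5) V(1) homeomorphic_imp_injective_map by blast
  then have "inj_on p V1"
    using T(3) V(1) openin_subset by (metis inf.absorb2 topspace_subtopology)
  then have "V1 \<noteq> V2"
    using V assms(4,5) by (auto dest: inj_onD)
  then show ?thesis
    using that[of V1 V2] T(3) V pairwiseD[OF T(4) V(1,3)] by blast
qed

text \<open>The agreement set \<open>A\<close> is clopen: local injectivity of \<open>p\<close>
  makes it open, and disjoint neighbourhoods of distinct points of a fibre make its complement open.
  It contains \<open>z0\<close>, so by connectedness it is everything.\<close>

lemma covering_map_unique_lift:
  assumes cov: "covering_map E X p" and Z: "connected_space Z"
    and f1: "continuous_map Z E f1" and f2: "continuous_map Z E f2"
    and eq: "\<And>z. z \<in> topspace Z \<Longrightarrow> p (f1 z) = p (f2 z)"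
    and z0: "z0 \<in> topspace Z" "f1 z0 = f2 z0" and z: "z \<in> topspace Z"
  shows "f1 z = f2 z"
proof -
  define A where "A = {z \<in> topspace Z. f1 z = f2 z}"
  have in1: "f1 z \<in> topspace E" and in2: "f2 z \<in> topspace E" if "z \<in> topspace Z" for z
    using f1 f2 that continuous_map_image_subset_topspace by blast+
  have op: "openin Z ({z \<in> topspace Z. f1 z \<in> V1} \<inter> {z \<in> topspace Z. f2 z \<in> V2})"
    if "openin E V1" "openin E V2" for V1 V2
    using openin_continuous_map_preimage[OF f1 that(1)] openin_continuous_map_preimage[OF f2 that(2)]
    by (rule openin_Int)
  have "openin Z A"
  proof (subst openin_subopen, intro ballI)
    fix z assume z: "z \<in> A"
    obtain V where V: "openin E V" "f1 z \<in> V" "inj_on p V"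
      using covering_map_locally_injective[OF cov] in1 z unfolding A_def by blast
    show "\<exists>T. openin Z T \<and> z \<in> T \<and> T \<subseteq> A"
      using op[OF V(1) V(1)] V z eq unfolding A_def
      by (intro exI[of _ "{z \<in> topspace Z. f1 z \<in> V} \<inter> {z \<in> topspace Z. f2 z \<in> V}"])
        (auto simp: inj_on_def)
  qed
  moreover have "openin Z (topspace Z - A)"
  proof (subst openin_subopen, intro ballI)
    fix z assume z: "z \<in> topspace Z - A"
    obtain V1 V2 where V: "openin E V1" "openin E V2" "f1 z \<in> V1" "f2 z \<in> V2" "disjnt V1 V2"
      using covering_map_separates_fibre[OF cov in1 in2 eq] z unfolding A_def by blast
    show "\<exists>T. openin Z T \<and> z \<in> T \<and> T \<subseteq> topspace Z - A"
      using op[OF V(1,2)] V z unfolding A_def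
      by (intro exI[of _ "{z \<in> topspace Z. f1 z \<in> V1} \<inter> {z \<in> topspace Z. f2 z \<in> V2}"])
        (auto simp: disjnt_iff)
  qed
  ultimately have "A = {} \<or> A = topspace Z"
    using Z unfolding connected_space_clopen_in closedin_def by (auto simp: A_def)
  then show ?thesis
    using z0 z by (auto simp: A_def)
qed

section \<open>Gluing partial lifts and lifting over the unit square\<close>

text \<open>The lift may be prescribed at any point \<open>q\<close> of \<open>A\<close> and at any
  point \<open>e\<close> of the fibre over \<open>f q\<close>. This freedom lets a lift on one piece
  be continued to a neighbouring piece from the value already reached.\<close>

definition lifts_on :: "'e topology \<Rightarrow> ('e \<Rightarrow> 'x) \<Rightarrow> 'z topology \<Rightarrow> ('z \<Rightarrow> 'x) \<Rightarrow> 'z set \<Rightarrow> bool" where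
  "lifts_on E p Z f A \<longleftrightarrow>
     (\<forall>q\<in>A. \<forall>e\<in>topspace E. p e = f q \<longrightarrow>
        (\<exists>k. continuous_map (subtopology Z A) E k \<and> (\<forall>z\<in>A. p (k z) = f z) \<and> k q = e))"

text \<open>A lift \<open>k\<close> on \<open>A\<close> has a value at a common point
  \<open>r\<close>, and some lift \<open>l\<close> on \<open>B\<close> takes the same value there.
  Uniqueness on the connected intersection makes \<open>k\<close> and \<open>l\<close> agree on it,
  and they paste because both pieces are closed.\<close>

lemma lifts_on_Un:
  assumes cov: "covering_map E X p"
    and A: "closedin Z A" "lifts_on E p Z f A" and B: "closedin Z B" "lifts_on E p Z f B"
    and AB: "connectedin Z (A \<inter> B)" "A \<inter> B \<noteq> {}"
  shows "lifts_on E p Z f (A \<union> B)"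
proof -
  \<comment> \<open>Stated for any two sets with the base point in the first, so that a base point
    in \<open>B\<close> is handled by exchanging the roles of the two sets.\<close>
  have *: "\<exists>k. continuous_map (subtopology Z (A \<union> B)) E k \<and> (\<forall>z\<in>A \<union> B. p (k z) = f z) \<and> k q = e"
    if q: "q \<in> A" "e \<in> topspace E" "p e = f q"
      and A: "closedin Z A" "lifts_on E p Z f A" and B: "closedin Z B" "lifts_on E p Z f B"
      and AB: "connectedin Z (A \<inter> B)" "A \<inter> B \<noteq> {}" for q e A B
  proof -
    obtain k where k: "continuous_map (subtopology Z A) E k" "\<forall>z\<in>A. p (k z) = f z" "k q = e"
      using A(2) q unfolding lifts_on_def by blast
    obtain r where r: "r \<in> A" "r \<in> B"
      using AB(2) by blast
    have sub: "A \<subseteq> topspace Z" "B \<subseteq> topspace Z"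
      using A(1) B(1) closedin_subset by blast+
    have "k r \<in> topspace E"
      using k(1) r sub by (auto simp: continuous_map_def Pi_iff)
    then obtain l where l: "continuous_map (subtopology Z B) E l" "\<forall>z\<in>B. p (l z) = f z" "l r = k r"
      using B(2) r k(2) unfolding lifts_on_def by metis
    have agree: "k z = l z" if "z \<in> A \<inter> B" for z
    proof (rule covering_map_unique_lift[OF cov connected_space_subtopology[OF AB(1)]])
      show "continuous_map (subtopology Z (A \<inter> B)) E k" "continuous_map (subtopology Z (A \<inter> B)) E l"
        using continuous_map_from_subtopology_mono k(1) l(1) by (metis Int_lower1 Int_lower2)+
    qed (use k l r sub that in auto)
    have "continuous_map (subtopology Z (A \<union> B)) E (\<lambda>z. if z \<in> A then k z else l z)"
    proof (rule pasting_lemma_closed[where I = "UNIV :: bool set"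
          and T = "\<lambda>b. if b then A else B" and f = "\<lambda>b. if b then k else l"])
      show "continuous_map (subtopology (subtopology Z (A \<union> B)) (if b then A else B)) E
              (if b then k else l)" for b
        using k l by (auto simp: subtopology_subtopology inf_absorb2)
      show "closedin (subtopology Z (A \<union> B)) (if b then A else B)" for b
        using A B by (auto intro!: closedin_subset_topspace)
      show "(if i then k else l) x = (if j then k else l) x"
        if "x \<in> topspace (subtopology Z (A \<union> B)) \<inter> (if i then A else B) \<inter> (if j then A else B)"
        for i j x
        using agree that by (auto split: if_splits)
      show "\<exists>j. j \<in> UNIV \<and> x \<in> (if j then A else B) \<and>
              (if x \<in> A then k x else l x) = (if j then k else l) x"
        if "x \<in> topspace (subtopology Z (A \<union> B))" for x
        using that by (intro exI[of _ "x \<in> A"]) auto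
    qed auto
    then show ?thesis
      using k l q by (intro exI[of _ "\<lambda>z. if z \<in> A then k z else l z"]) auto
  qed
  show ?thesis
    unfolding lifts_on_def
  proof (intro ballI impI)
    fix q e assume "q \<in> A \<union> B" and e: "e \<in> topspace E" "p e = f q"
    then consider "q \<in> A" | "q \<in> B" by blast
    then show "\<exists>k. continuous_map (subtopology Z (A \<union> B)) E k \<and> (\<forall>z\<in>A \<union> B. p (k z) = f z) \<and> k q = e"
    proof cases
      case 1
      from *[OF 1 e A B AB] show ?thesis .
    next
      case 2
      from *[OF 2 e B A] AB show ?thesis by (simp add: Un_commute Int_commute)
    qed
  qed
qed

text \<open>Take for \<open>N\<close> the preimage of an evenly covered set \<open>T\<close>. On the
  sheet through the prescribed point \<open>p\<close> has a continuous inverse \<open>h\<close>, and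
  \<open>h \<circ> f\<close> is a lift on every subset of \<open>N\<close>.\<close>

lemma lifts_on_local:
  assumes cov: "covering_map E X p" and f: "continuous_map Z X f" and z: "z \<in> topspace Z"
  obtains N where "openin Z N" "z \<in> N" "\<And>A. A \<subseteq> N \<Longrightarrow> lifts_on E p Z f A"
proof -
  have "f z \<in> topspace X"
    using f z by (auto simp: continuous_map_def)
  then obtain T \<V> where T: "f z \<in> T" "openin X T" "\<Union>\<V> = topspace E \<inter> p -` T"
      "\<forall>V\<in>\<V>. homeomorphic_map (subtopology E V) (subtopology X T) p"
    using cov unfolding covering_map_def by meson
  define N where "N = {z \<in> topspace Z. f z \<in> T}"
  have "lifts_on E p Z f A" if A: "A \<subseteq> N" for A
    unfolding lifts_on_def
  proof (intro ballI impI)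
    fix q e assume q: "q \<in> A" and e: "e \<in> topspace E" "p e = f q"
    have "p e \<in> T" using q e A by (auto simp: N_def)
    then obtain V where V: "V \<in> \<V>" "e \<in> V"
      using T(3) e by blast
    then obtain h where h: "homeomorphic_maps (subtopology E V) (subtopology X T) p h"
      using T(4) unfolding homeomorphic_map_maps by blast
    have fA: "continuous_map (subtopology Z A) (subtopology X T) f"
      using A by (intro continuous_map_into_subtopology continuous_map_from_subtopology f) (auto simp: N_def)
    have hc: "continuous_map (subtopology X T) E h"
      using h continuous_map_into_fulltopology unfolding homeomorphic_maps_def by blast
    have 1: "continuous_map (subtopology Z A) E (h \<circ> f)"
      by (rule continuous_map_compose[OF fA hc])
    have 2: "p ((h \<circ> f) z) = f z" if "z \<in> A" for z
      using h that A openin_subset[OF T(2)] unfolding homeomorphic_maps_def N_def by (auto simp: subset_iff)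
    have "h (p e) = e"
      using h e(1) V(2) unfolding homeomorphic_maps_def by auto
    then show "\<exists>k. continuous_map (subtopology Z A) E k \<and> (\<forall>z\<in>A. p (k z) = f z) \<and> k q = e"
      using 1 2 e by (intro exI[of _ "h \<circ> f"]) auto
  qed
  then show ?thesis
    using that[of N] openin_continuous_map_preimage[OF f T(2)] z T(1) by (auto simp: N_def)
qed

text \<open>Small rectangles lift by \<open>lifts_on_local\<close>; rectangles with a common side
  glue by \<open>lifts_on_Un\<close>, since a segment is connected.\<close>

lemma covering_map_lift_square:
  fixes f :: "real \<times> real \<Rightarrow> 'x"
  assumes cov: "covering_map E X p" and f: "continuous_map (top_of_set ({0..1} \<times> {0..1})) X f"
    and q: "q \<in> {0..1} \<times> {0..1}" and e: "e \<in> topspace E" "p e = f q"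
  shows "\<exists>k. continuous_map (top_of_set ({0..1} \<times> {0..1})) E k \<and>
           (\<forall>z\<in>{0..1} \<times> {0..1}. p (k z) = f z) \<and> k q = e"
proof -
  let ?Z = "top_of_set ({0..1} \<times> {0..1}) :: (real \<times> real) topology"
  define L where "L a b c d \<longleftrightarrow> lifts_on E p ?Z f ({a..b} \<times> {c..d})" for a b c d :: real
  txt \<open>\<open>Q s a b\<close>: lifts exist on \<open>{a..b} \<times> J\<close> for every small enough interval \<open>J\<close> around \<open>s\<close>.
    Bolzano's principle is applied twice, first to \<open>Q s\<close> and then to the strips \<open>{0..1} \<times> {c..d}\<close>.\<close>
  define Q where "Q s a b \<longleftrightarrow> (0 \<le> a \<and> b \<le> 1 \<longrightarrow>
      (\<exists>\<delta>>0. \<forall>c d. 0 \<le> c \<and> d \<le> 1 \<and> c \<le> s \<and> s \<le> d \<and> d - c < \<delta> \<longrightarrow> L a b c d))" for s a b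
  define P where "P c d \<longleftrightarrow> (0 \<le> c \<and> d \<le> 1 \<longrightarrow> L 0 1 c d)" for c d
  have closed: "closedin ?Z ({a..b} \<times> {c..d})" if "0 \<le> a" "b \<le> 1" "0 \<le> c" "d \<le> 1" for a b c d :: real
    using that by (intro closed_subset) (auto intro: closed_Times)
  \<comment> \<open>\<open>glue1\<close> joins rectangles along a vertical segment,
    \<open>glue2\<close> along a horizontal one. The ordering assumptions make the intersection
    exactly that segment, and nonempty.\<close>
  have glue1: "L a c s t" if "L a b s t" "L b c s t" "0 \<le> a" "a \<le> b" "b \<le> c" "c \<le> 1"
    "0 \<le> s" "s \<le> t" "t \<le> 1" for a b c s t
  proof -
    have eq: "{a..c} \<times> {s..t} = {a..b} \<times> {s..t} \<union> {b..c} \<times> {s..t}"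
      "{a..b} \<times> {s..t} \<inter> {b..c} \<times> {s..t} = {b} \<times> {s..t}"
      using that by auto
    have "connected ({b} \<times> {s..t})" by (intro connected_Times) auto
    then show ?thesis
      using that unfolding L_def eq(1)
      by (intro lifts_on_Un[OF cov]) (auto simp: eq(2) closed connectedin_subtopology)
  qed
  have glue2: "L a b s u" if "L a b s t" "L a b t u" "0 \<le> a" "a \<le> b" "b \<le> 1"
    "0 \<le> s" "s \<le> t" "t \<le> u" "u \<le> 1" for a b s t u
  proof -
    have eq: "{a..b} \<times> {s..u} = {a..b} \<times> {s..t} \<union> {a..b} \<times> {t..u}"
      "{a..b} \<times> {s..t} \<inter> {a..b} \<times> {t..u} = {a..b} \<times> {t}"
      using that by auto
    have "connected ({a..b} \<times> {t})" by (intro connected_Times) auto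
    then show ?thesis
      using that unfolding L_def eq(1)
      by (intro lifts_on_Un[OF cov]) (auto simp: eq(2) closed connectedin_subtopology)
  qed
  have "Q s 0 1" if s: "0 \<le> s" "s \<le> 1" for s
    using zero_le_one
  proof (induction rule: Bolzano[where P = "Q s"])
    case (trans a b c)
    show ?case
      unfolding Q_def
    proof (intro impI)
      assume ac: "0 \<le> a \<and> c \<le> 1"
      with trans(3,4) have b: "0 \<le> b" "b \<le> 1" by auto
      obtain d1 where d1: "d1 > 0" "\<And>u d. 0 \<le> u \<and> d \<le> 1 \<and> u \<le> s \<and> s \<le> d \<and> d - u < d1 \<Longrightarrow> L a b u d"
        using trans(1) ac b unfolding Q_def by blast
      obtain d2 where d2: "d2 > 0" "\<And>u d. 0 \<le> u \<and> d \<le> 1 \<and> u \<le> s \<and> s \<le> d \<and> d - u < d2 \<Longrightarrow> L b c u d"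
        using trans(2) ac b unfolding Q_def by blast
      have "L a c u d" if "0 \<le> u \<and> d \<le> 1 \<and> u \<le> s \<and> s \<le> d \<and> d - u < min d1 d2" for u d
        using that d1(2)[of u d] d2(2)[of u d] ac trans(3,4) by (intro glue1[of a b u d c]) auto
      then show "\<exists>\<delta>>0. \<forall>u d. 0 \<le> u \<and> d \<le> 1 \<and> u \<le> s \<and> s \<le> d \<and> d - u < \<delta> \<longrightarrow> L a c u d"
        using d1(1) d2(1) by (intro exI[of _ "min d1 d2"]) simp
    qed
  next
    \<comment> \<open>A rectangle containing \<open>(x, s)\<close> with sides shorter than
      \<open>d1\<close> and \<open>d2\<close> stays in a box inside \<open>N\<close>. The height
      \<open>d2\<close> depends on \<open>x\<close>, which is why \<open>Q\<close> claims only some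
      bound; the gluing case takes the minimum of two.\<close>
    case (local x)
    have "(x, s) \<in> topspace ?Z" using local s by auto
    from lifts_on_local[OF cov f this] obtain N where N: "openin ?Z N" "(x, s) \<in> N"
      "\<And>A. A \<subseteq> N \<Longrightarrow> lifts_on E p ?Z f A" by metis
    then obtain U where U: "open U" "N = ({0..1} \<times> {0..1}) \<inter> U"
      by (auto simp: openin_open)
    then have "(x, s) \<in> U" using N(2) by blast
    then obtain A B where AB: "open A" "open B" "x \<in> A" "s \<in> B" "A \<times> B \<subseteq> U"
      using open_prod_elim[OF U(1)] by (metis mem_Sigma_iff)
    obtain d1 where d1: "d1 > 0" "ball x d1 \<subseteq> A" using AB open_contains_ball by blast
    obtain d2 where d2: "d2 > 0" "ball s d2 \<subseteq> B" using AB open_contains_ball by blast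
    have "L a b c d" if "a \<le> x" "x \<le> b" "b - a < d1" "0 \<le> a" "b \<le> 1" "0 \<le> c" "d \<le> 1" "c \<le> s" "s \<le> d" "d - c < d2"
      for a b c d
    proof -
      have "{a..b} \<subseteq> ball x d1" "{c..d} \<subseteq> ball s d2"
        using that by (auto simp: dist_real_def)
      with d1(2) d2(2) have "{a..b} \<times> {c..d} \<subseteq> A \<times> B"
        by (intro Sigma_mono) auto
      moreover have "{a..b} \<times> {c..d} \<subseteq> {0..1} \<times> {0..1}"
        using that by (intro Sigma_mono) auto
      ultimately have "{a..b} \<times> {c..d} \<subseteq> N"
        unfolding U(2) using AB(5) by blast
      then show ?thesis unfolding L_def by (rule N(3))
    qed
    then have "Q s a b" if "a \<le> x" "x \<le> b" "b - a < d1" for a b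
      unfolding Q_def using that d2(1) by blast
    then show ?case
      using d1(1) by blast
  qed
  then have Q: "Q s 0 1" if "0 \<le> s" "s \<le> 1" for s using that by blast
  have "P 0 1"
    using zero_le_one
  proof (induction rule: Bolzano[where P = P])
    case (trans a b c)
    then show ?case
      using glue2[of 0 1 a b c] unfolding P_def by simp
  next
    case (local x)
    obtain d where "d > 0" "\<forall>a b. 0 \<le> a \<and> b \<le> 1 \<and> a \<le> x \<and> x \<le> b \<and> b - a < d \<longrightarrow> L 0 1 a b"
      using Q[OF local] unfolding Q_def by auto
    then show ?case
      unfolding P_def by blast
  qed
  then have "lifts_on E p ?Z f ({0..1} \<times> {0..1})"
    by (simp add: P_def L_def)
  from this[unfolded lifts_on_def, rule_format, OF q e] show ?thesis
    by (simp add: subtopology_subtopology)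
qed

section \<open>Lifting paths and homotopies of paths\<close>

text \<open>The path is spread over the square as \<open>c \<circ> fst\<close>, and the lift of this
  map is restricted to the edge of points \<open>(t, 0)\<close>.\<close>

lemma covering_map_lift_path:
  assumes cov: "covering_map E X p" and c: "pathin X c" and e: "e \<in> topspace E" "p e = c 0"
  shows "\<exists>c'. pathin E c' \<and> (\<forall>t\<in>{0..1}. p (c' t) = c t) \<and> c' 0 = e"
proof -
  have 1: "continuous_map (top_of_set ({0..1} \<times> {0..1})) X (c \<circ> fst)"
    using c unfolding pathin_def
    by (intro continuous_map_compose[where X' = "top_of_set {0..1}"]) (auto simp: continuous_on_fst)
  have 2: "(0 :: real, 0 :: real) \<in> {0..1} \<times> {0..1}" and 3: "p e = (c \<circ> fst) (0, 0)"
    using e by auto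
  obtain k :: "real \<times> real \<Rightarrow> _" where k: "continuous_map (top_of_set ({0..1} \<times> {0..1})) E k"
    "\<forall>z\<in>{0..1} \<times> {0..1}. p (k z) = (c \<circ> fst) z" "k (0, 0) = e"
    using covering_map_lift_square[OF cov 1 2 e(1) 3] by blast
  have "pathin E (k \<circ> (\<lambda>t. (t, 0)))"
    unfolding pathin_def
    by (intro continuous_map_compose[OF _ k(1)]) (auto intro!: continuous_intros)
  then show ?thesis
    using k(2,3) by (intro exI[of _ "k \<circ> (\<lambda>t. (t, 0))"]) auto
qed

lemma pathin_unique_lift:
  assumes cov: "covering_map E X p" and c: "pathin E c" "pathin E d"
    and "\<And>t. t \<in> {0..1} \<Longrightarrow> p (c t) = p (d t)" "c 0 = d 0" "t \<in> {0..1}"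
  shows "c t = d t"
proof (rule covering_map_unique_lift[OF cov _ c[unfolded pathin_def]])
  show "connected_space (top_of_set {0..1::real})"
    by (rule connected_space_subtopology) simp
qed (use assms in auto)

lemma pathin_square:
  fixes a b :: "real \<Rightarrow> real"
  assumes "continuous_map (top_of_set ({0..1} \<times> {0..1})) X H"
    "continuous_on {0..1} a" "continuous_on {0..1} b"
    "a \<in> {0..1} \<rightarrow> {0..1}" "b \<in> {0..1} \<rightarrow> {0..1}"
  shows "pathin X (\<lambda>t. H (a t, b t))"
proof -
  have "pathin X (H \<circ> (\<lambda>t. (a t, b t)))"
    unfolding pathin_def using assms
    by (intro continuous_map_compose[OF _ assms(1)]) (auto intro!: continuous_intros)
  then show ?thesis by (simp add: o_def)
qed

lemma pathin_reparametrize: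
  fixes a :: "real \<Rightarrow> real"
  assumes "pathin X c" "continuous_on {0..1} a" "a \<in> {0..1} \<rightarrow> {0..1}"
  shows "pathin X (\<lambda>t. c (a t))"
proof -
  have "pathin X (c \<circ> a)"
    using assms(1) unfolding pathin_def
    by (rule continuous_map_compose[rotated]) (use assms in auto)
  then show ?thesis by (simp add: o_def)
qed

text \<open>If also \<open>c 0 = d 0\<close>, the result is a loop, the form in which simple
  connectedness is stated. The same construction prolongs \<open>c\<close> to the starting point of
  \<open>d\<close>.\<close>

lemma pathin_join_reversed:
  assumes c: "pathin X c" and d: "pathin X d" and cd: "c 1 = d 1"
  shows "pathin X (\<lambda>t. if t \<le> 1 / 2 then c (2 * t) else d (2 - 2 * t))"
  unfolding pathin_def
proof (rule continuous_map_cases_le)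
  have "continuous_map (top_of_set {0..1/2}) X (c \<circ> (\<lambda>t. 2 * t))"
    using c unfolding pathin_def
    by (rule continuous_map_compose[rotated]) (auto intro!: continuous_intros)
  moreover have "{0..1} \<inter> {x \<in> topspace (top_of_set {0..1}). x \<le> 1 / 2} = {0..1/2::real}" by auto
  ultimately show "continuous_map (subtopology (top_of_set {0..1})
      {x \<in> topspace (top_of_set {0..1}). x \<le> 1 / 2}) X (\<lambda>t. c (2 * t))"
    by (simp only: subtopology_subtopology o_def)
  have "continuous_map (top_of_set {1/2..1}) X (d \<circ> (\<lambda>t. 2 - 2 * t))"
    using d unfolding pathin_def
    by (rule continuous_map_compose[rotated]) (auto intro!: continuous_intros)
  moreover have "{0..1} \<inter> {x \<in> topspace (top_of_set {0..1}). 1 / 2 \<le> x} = {1/2..1::real}" by auto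
  ultimately show "continuous_map (subtopology (top_of_set {0..1})
      {x \<in> topspace (top_of_set {0..1}). 1 / 2 \<le> x}) X (\<lambda>t. d (2 - 2 * t))"
    by (simp only: subtopology_subtopology o_def)
  show "c (2 * t) = d (2 - 2 * t)" if "t = 1 / 2" for t :: real
    using cd by (simp add: that)
qed auto

text \<open>Let \<open>K\<close> lift \<open>H\<close> from \<open>c 0\<close>, the first coordinate
  being the homotopy parameter. It restricts to \<open>c\<close> on the side \<open>s = 0\<close>.
  It is constant on the two sides where \<open>H\<close> is, so on the side \<open>s = 1\<close> it
  starts at \<open>d 0\<close> and restricts to \<open>d\<close>, with the same end.\<close>

lemma lift_homotopic_paths_endpoint:
  fixes H :: "real \<times> real \<Rightarrow> 'x"
  assumes cov: "covering_map E X p"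
    and H: "continuous_map (top_of_set ({0..1} \<times> {0..1})) X H"
    and H01: "\<And>s. s \<in> {0..1} \<Longrightarrow> H (s, 0) = H (0, 0)" "\<And>s. s \<in> {0..1} \<Longrightarrow> H (s, 1) = H (0, 1)"
    and c: "pathin E c" "\<And>t. t \<in> {0..1} \<Longrightarrow> p (c t) = H (0, t)"
    and d: "pathin E d" "\<And>t. t \<in> {0..1} \<Longrightarrow> p (d t) = H (1, t)"
    and cd: "c 0 = d 0"
  shows "c 1 = d 1"
proof -
  have 1: "(0 :: real, 0 :: real) \<in> {0..1} \<times> {0..1}" and 2: "c 0 \<in> topspace E" and 3: "p (c 0) = H (0, 0)"
    using c path_start_in_topspace by auto
  obtain K where K: "continuous_map (top_of_set ({0..1} \<times> {0..1})) E K"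
    "\<forall>z\<in>{0..1} \<times> {0..1}. p (K z) = H z" "K (0, 0) = c 0"
    using covering_map_lift_square[OF cov H 1 2 3] by blast
  have path: "pathin E (\<lambda>t. K (t, r))" "pathin E (\<lambda>t. K (r, t))" if "r \<in> {0..1}" for r
    using pathin_square[OF K(1), of "\<lambda>t. t" "\<lambda>t. r"] pathin_square[OF K(1), of "\<lambda>t. r" "\<lambda>t. t"] that
    by (auto intro: continuous_intros)
  have KE: "K z \<in> topspace E" if "z \<in> {0..1} \<times> {0..1}" for z
    using K(1) that by (auto simp: continuous_map_def)
  \<comment> \<open>\<open>H\<close> is constant along this edge, so a constant path lifts it too,
    and uniqueness of path lifts makes \<open>K\<close> constant there.\<close>
  have edge: "K (1, r) = K (0, r)" if r: "r \<in> {0, 1}" for r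
  proof (rule pathin_unique_lift[OF cov path(1), where d = "\<lambda>t. K (0, r)"])
    show "pathin E (\<lambda>t. K (0, r))" using KE r by auto
    show "p (K (t, r)) = p (K (0, r))" if "t \<in> {0..1}" for t
      using K(2)[rule_format, of "(t, r)"] K(2)[rule_format, of "(0, r)"] H01[of t] r that by auto
  qed (use r in auto)
  have "K (0, 1) = c 1"
    by (rule pathin_unique_lift[OF cov path(2) c(1)]) (use K(2,3) c(2) in auto)
  moreover have "K (1, 1) = d 1"
    by (rule pathin_unique_lift[OF cov path(2) d(1)]) (use K(2,3) d(2) edge[of 0] cd in auto)
  ultimately show ?thesis
    using edge[of 1] by simp
qed

section \<open>The lifting criterion for simply connected spaces\<close>

lemma simply_connected_space_loop_square:
  assumes "simply_connected_space Z" "pathin Z c" "c 0 = c 1"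
  shows "\<exists>H :: real \<times> real \<Rightarrow> _. continuous_map (top_of_set ({0..1} \<times> {0..1})) Z H \<and>
           (\<forall>t. H (0, t) = c t \<and> H (1, t) = c 0) \<and> (\<forall>s\<in>{0..1}. H (s, 0) = c 0 \<and> H (s, 1) = c 0)"
proof -
  have "homotopic_with (\<lambda>q. q 0 = c 0 \<and> q 1 = c 0) (top_of_set {0..1}) Z c (\<lambda>_. c 0)"
    using assms unfolding simply_connected_space_def by blast
  then show ?thesis
    unfolding homotopic_with_def prod_topology_subtopology_eu by blast
qed

text \<open>The loop \<open>l\<close>, which is \<open>c\<close> followed by \<open>d\<close>
  backwards, contracts in \<open>Z\<close>, so its lift \<open>l'\<close> closes up. Read from its
  two ends, \<open>l'\<close> is \<open>c'\<close> and \<open>d'\<close>, which meet at time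
  \<open>1 / 2\<close>. This path independence makes the map built in
  \<open>covering_map_lift\<close> well defined.\<close>

lemma simply_connected_lift_paths_endpoint:
  assumes cov: "covering_map E X p" and Z: "simply_connected_space Z" and f: "continuous_map Z X f"
    and c: "pathin Z c" "pathin E c'" "\<And>t. t \<in> {0..1} \<Longrightarrow> p (c' t) = f (c t)"
    and d: "pathin Z d" "pathin E d'" "\<And>t. t \<in> {0..1} \<Longrightarrow> p (d' t) = f (d t)"
    and cd: "c 0 = d 0" "c 1 = d 1" "c' 0 = d' 0"
  shows "c' 1 = d' 1"
proof -
  define l where "l t = (if t \<le> 1 / 2 then c (2 * t) else d (2 - 2 * t))" for t :: real
  have l: "pathin Z l"
    unfolding l_def by (rule pathin_join_reversed[OF c(1) d(1) cd(2)])
  have l01: "l 0 = c 0" "l 1 = c 0"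
    using cd by (auto simp: l_def)
  then obtain H :: "real \<times> real \<Rightarrow> _" where H: "continuous_map (top_of_set ({0..1} \<times> {0..1})) Z H"
    "\<forall>t. H (0, t) = l t \<and> H (1, t) = l 0" "\<forall>s\<in>{0..1}. H (s, 0) = l 0 \<and> H (s, 1) = l 0"
    using simply_connected_space_loop_square[OF Z l] by auto
  have c0: "c' 0 \<in> topspace E" "p (c' 0) = (f \<circ> l) 0"
    using c path_start_in_topspace l01 by auto
  obtain l' where l': "pathin E l'" "\<forall>t\<in>{0..1}. p (l' t) = f (l t)" "l' 0 = c' 0"
    using covering_map_lift_path[OF cov pathin_compose[OF l f] c0] unfolding comp_apply by blast
  \<comment> \<open>\<open>f \<circ> H\<close> deforms \<open>f \<circ> l\<close> to a constant path
    with ends fixed, and that path has a constant lift, so \<open>l'\<close> ends where it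
    starts.\<close>
  have "l' 1 = c' 0"
  proof (rule lift_homotopic_paths_endpoint[OF cov continuous_map_compose[OF H(1) f] _ _ l'(1)])
    show "pathin E (\<lambda>t. c' 0)" using c0 by simp
  qed (use H l' l01 c(3) in auto)
  have "l' (1 / 2) = c' 1"
    by (rule pathin_unique_lift[OF cov pathin_reparametrize[OF l'(1), of "\<lambda>t. t / 2"] c(2),
          of 1, simplified])
      (use l' c in \<open>auto simp: l_def intro!: continuous_intros\<close>)
  \<comment> \<open>Reading \<open>l'\<close> backwards from time 1 gives a lift of
    \<open>f \<circ> d\<close> that starts at \<open>l' 1 = c' 0 = d' 0\<close>, hence
    \<open>d'\<close>.\<close>
  moreover have "l' (1 / 2) = d' 1"
    by (rule pathin_unique_lift[OF cov pathin_reparametrize[OF l'(1), of "\<lambda>t. 1 - t / 2"] d(2),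
          of 1, simplified])
      (use l' d cd \<open>l' 1 = c' 0\<close> in \<open>auto simp: l_def intro!: continuous_intros\<close>)
  ultimately show ?thesis by simp
qed

text \<open>The value at \<open>z\<close> is the end of a lifted path over some path from
  \<open>z0\<close> to \<open>z\<close>; path independence removes the choice. Local path
  connectedness gives continuity: near each point the map agrees with a local lift.\<close>

lemma covering_map_lift:
  assumes cov: "covering_map E X p" and Z: "simply_connected_space Z" "locally_path_connected_space Z"
    and f: "continuous_map Z X f" and z0: "z0 \<in> topspace Z" and e0: "e0 \<in> topspace E" "p e0 = f z0"
  shows "\<exists>f'. continuous_map Z E f' \<and> (\<forall>z\<in>topspace Z. p (f' z) = f z) \<and> f' z0 = e0"
proof -
  define R where "R c c' \<longleftrightarrow> pathin Z c \<and> c 0 = z0 \<and> pathin E c' \<and> c' 0 = e0 \<and>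
      (\<forall>t\<in>{0..1}. p (c' t) = f (c t))" for c c'
  have "\<exists>c c'. R c c' \<and> c 1 = z" if z: "z \<in> topspace Z" for z
  proof -
    obtain c where c: "pathin Z c" "c 0 = z0" "c 1 = z"
      using Z(1) z0 z unfolding simply_connected_space_def path_connected_space_def by blast
    then have "p e0 = (f \<circ> c) 0"
      using e0 by simp
    from covering_map_lift_path[OF cov pathin_compose[OF c(1) f] e0(1) this] show ?thesis
      using c unfolding R_def comp_apply by blast
  qed
  then obtain C C' where C: "\<And>z. z \<in> topspace Z \<Longrightarrow> R (C z) (C' z) \<and> C z 1 = z"
    by metis
  define F where "F z = C' z 1" for z
  \<comment> \<open>\<open>C\<close> and \<open>C'\<close> are arbitrary choices; any other path
    with a lift computes the same value of \<open>F\<close>.\<close>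
  have F: "F (c 1) = c' 1" if c: "R c c'" for c c'
  proof -
    have "c 1 \<in> topspace Z"
      using c path_finish_in_topspace by (auto simp: R_def)
    from C[OF this] c show ?thesis
      unfolding F_def R_def
      by (intro simply_connected_lift_paths_endpoint[OF cov Z(1) f, of "C (c 1)" "C' (c 1)" c c']) auto
  qed
  have pF: "p (F z) = f z" and FE: "F z \<in> topspace E" if "z \<in> topspace Z" for z
    using C[OF that] path_finish_in_topspace unfolding F_def R_def by auto
  have local: "\<exists>U. openin Z U \<and> z \<in> U \<and> continuous_map (subtopology Z U) E F" if z: "z \<in> topspace Z" for z
  proof -
    obtain N where N: "openin Z N" "z \<in> N" "\<And>A. A \<subseteq> N \<Longrightarrow> lifts_on E p Z f A"
      using lifts_on_local[OF cov f z] by metis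
    then obtain U where U: "openin Z U" "path_connectedin Z U" "z \<in> U" "U \<subseteq> N"
      using Z(2) unfolding locally_path_connected_space by metis
    obtain k where k: "continuous_map (subtopology Z U) E k" "\<forall>w\<in>U. p (k w) = f w" "k z = F z"
      using N(3)[OF U(4)] U(3) pF[OF z] FE[OF z] unfolding lifts_on_def by meson
    \<comment> \<open>Reach \<open>w\<close> by the chosen path to \<open>z\<close> and then from
      \<open>z\<close> to \<open>w\<close> inside \<open>U\<close>. Its lift is \<open>C' z\<close>
      followed by \<open>k\<close> along the second part. The path \<open>d\<close> runs from
      \<open>w\<close> to \<open>z\<close> because the join reverses it.\<close>
    have "k w = F w" if w: "w \<in> topspace (subtopology Z U)" for w
    proof -
      have "z \<in> topspace (subtopology Z U)"
        using z U(3) by simp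
      then obtain d where d: "pathin (subtopology Z U) d" "d 0 = w" "d 1 = z"
        using U(2) w unfolding path_connectedin_def path_connected_space_def by blast
      have dU: "d t \<in> U" if "t \<in> {0..1}" for t
        using d(1) that unfolding pathin_subtopology by blast
      have dZ: "pathin Z d" and kd: "pathin E (\<lambda>t. k (d t))"
        using d(1) pathin_compose[OF d(1) k(1)] by (auto simp: pathin_subtopology o_def)
      let ?c = "\<lambda>t. if t \<le> 1 / 2 then C z (2 * t) else d (2 - 2 * t)"
      let ?c' = "\<lambda>t. if t \<le> 1 / 2 then C' z (2 * t) else k (d (2 - 2 * t))"
      have Cz: "pathin Z (C z)" "C z 0 = z0" "C z 1 = z" "pathin E (C' z)" "C' z 0 = e0" "C' z 1 = F z"
        "\<forall>t\<in>{0..1}. p (C' z t) = f (C z t)"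
        using C[OF z] by (auto simp: R_def F_def)
      have "pathin Z ?c"
        by (rule pathin_join_reversed) (use Cz d dZ in auto)
      moreover have "pathin E ?c'"
        by (rule pathin_join_reversed) (use Cz d(3) kd k(3) in auto)
      ultimately have "R ?c ?c'"
        using Cz k(2) dU unfolding R_def by auto
      from F[OF this] show ?thesis
        using d(2) by simp
    qed
    then show ?thesis
      using U continuous_map_eq[OF k(1)] by blast
  qed
  then obtain U where U: "\<And>z. z \<in> topspace Z \<Longrightarrow> openin Z (U z) \<and> z \<in> U z \<and> continuous_map (subtopology Z (U z)) E F"
    by metis
  have "continuous_map Z E F"
    by (rule pasting_lemma[where I = "topspace Z" and T = U and f = "\<lambda>_. F"]) (use U in auto)
  \<comment> \<open>The constant path at \<open>z0\<close>, with its constant lift, computes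
    \<open>F z0 = e0\<close>.\<close>
  moreover have "R (\<lambda>_. z0) (\<lambda>_. e0)"
    using z0 e0 by (simp add: R_def)
  ultimately show ?thesis
    using pF F by blast
qed

text \<open>\<open>p\<close> carries a sheet homeomorphically to an open set of \<open>X\<close>, so
  a path connected open \<open>U\<close> inside the image of \<open>V \<inter> W\<close> pulls back
  along \<open>h\<close>. Applied to the torus, this supplies the local hypothesis of
  \<open>covering_map_lift\<close>.\<close>

lemma covering_map_locally_path_connected:
  assumes cov: "covering_map E X p" and X: "locally_path_connected_space X"
  shows "locally_path_connected_space E"
  unfolding locally_path_connected_space
proof (intro allI impI)
  fix V e assume "openin E V \<and> e \<in> V"
  then have V: "openin E V" "e \<in> V" by auto
  then have "e \<in> topspace E" using openin_subset by blast
  then obtain T W h where T: "openin X T" "p e \<in> T" and W: "openin E W" "e \<in> W"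
    and h: "homeomorphic_maps (subtopology E W) (subtopology X T) p h"
    using covering_map_sheet[OF cov] by metis
  have hom: "homeomorphic_map (subtopology E W) (subtopology X T) p"
    "homeomorphic_map (subtopology X T) (subtopology E W) h"
    using h homeomorphic_maps_sym homeomorphic_map_maps by blast+
  have sub: "V \<subseteq> topspace E" "W \<subseteq> topspace E" "T \<subseteq> topspace X"
    using V W T openin_subset by blast+
  have hp: "h (p x) = x" "p x \<in> T" if "x \<in> W" for x
    using h that sub unfolding homeomorphic_maps_def continuous_map_def by auto
  have "openin (subtopology E W) (V \<inter> W)"
    using V W by (simp add: openin_open_subtopology openin_Int)
  then have "openin (subtopology X T) (p ` (V \<inter> W))"
    using homeomorphic_imp_open_map[OF hom(1)] by (simp add: open_map_def)
  then have "openin X (p ` (V \<inter> W))"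
    using T(1) openin_trans_full by blast
  then obtain U where U: "openin X U" "path_connectedin X U" "p e \<in> U" "U \<subseteq> p ` (V \<inter> W)"
    using X V W unfolding locally_path_connected_space by (metis IntI imageI)
  have UT: "U \<subseteq> T"
    using U(4) hp by blast
  have "openin (subtopology E W) (h ` U)"
    using homeomorphic_imp_open_map[OF hom(2)] U(1) UT T(1)
    by (simp add: open_map_def openin_open_subtopology)
  then have "openin E (h ` U)"
    using W(1) openin_trans_full by blast
  moreover have "path_connectedin E (h ` U)"
  proof (rule path_connectedin_continuous_map_image)
    show "continuous_map (subtopology X T) E h"
      using homeomorphic_imp_continuous_map[OF hom(2)] continuous_map_into_fulltopology by blast
    show "path_connectedin (subtopology X T) U"
      using U UT by (simp add: path_connectedin_subtopology)
  qed
  moreover have "e \<in> h ` U"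
    using U(3) hp(1)[OF W(2)] by (metis imageI)
  moreover have "h ` U \<subseteq> V"
    using U(4) hp(1) by fastforce
  ultimately show "\<exists>U. openin E U \<and> path_connectedin E U \<and> e \<in> U \<and> U \<subseteq> V"
    by blast
qed

section \<open>The tori in the symmetric product\<close>

lemma locally_path_connected_space_top_of_set:
  "locally path_connected S \<Longrightarrow> locally_path_connected_space (top_of_set S)"
  unfolding locally_path_connected_space_def neighbourhood_base_of locally_def
  by (simp add: path_connectedin_subtopology) (meson openin_imp_subset subset_trans)

lemma locally_path_connected_space_torus: "locally_path_connected_space (torus g)"
proof -
  have "path_connected_space circle"
    by (simp add: path_connected_sphere)
  moreover have "locally_path_connected_space circle"
    by (intro locally_path_connected_space_top_of_set locally_path_connected_sphere)
  ultimately show ?thesis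
    unfolding torus_def locally_path_connected_space_product_topology by simp
qed

section \<open>The symmetric group acting on tuples\<close>

lemma sym_proj_eq_iff: "sym_proj g f = sym_proj g h \<longleftrightarrow> (\<exists>\<sigma>. \<sigma> permutes {..<g} \<and> h = f \<circ> \<sigma>)"
proof
  assume "sym_proj g f = sym_proj g h"
  moreover have "h \<in> sym_proj g h"
    unfolding sym_proj_def using permutes_id by (metis (mono_tags, lifting) comp_id mem_Collect_eq)
  ultimately have "h \<in> sym_proj g f" by simp
  then show "\<exists>\<sigma>. \<sigma> permutes {..<g} \<and> h = f \<circ> \<sigma>"
    unfolding sym_proj_def by blast
next
  assume "\<exists>\<sigma>. \<sigma> permutes {..<g} \<and> h = f \<circ> \<sigma>"
  then obtain \<sigma> where \<sigma>: "\<sigma> permutes {..<g}" "h = f \<circ> \<sigma>" by blast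
  have "f \<circ> \<tau> = h \<circ> (inv_into UNIV \<sigma> \<circ> \<tau>)" for \<tau>
    unfolding \<sigma>(2) using permutes_inv_o(1)[OF \<sigma>(1)] by (metis comp_assoc comp_id)
  then have "sym_proj g f \<subseteq> sym_proj g h"
    unfolding sym_proj_def using permutes_compose permutes_inv[OF \<sigma>(1)] by blast
  moreover have "sym_proj g h \<subseteq> sym_proj g f"
    unfolding sym_proj_def \<sigma>(2) using permutes_compose \<sigma>(1) by (auto simp: comp_assoc)
  ultimately show "sym_proj g f = sym_proj g h" by blast
qed

lemma continuous_map_permute_coordinates:
  assumes "\<sigma> permutes {..<g}"
  shows "continuous_map (product_topology (\<lambda>_. S) {..<g}) (product_topology (\<lambda>_. S) {..<g}) (\<lambda>f. f \<circ> \<sigma>)"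
  unfolding continuous_map_componentwise
proof (intro conjI ballI)
  show "(\<lambda>f. f \<circ> \<sigma>) ` topspace (product_topology (\<lambda>_. S) {..<g}) \<subseteq> extensional {..<g}"
    using permutes_not_in[OF assms] by (auto simp: extensional_def PiE_iff)
  fix k assume "k \<in> {..<g}"
  then have "\<sigma> k \<in> {..<g}"
    using permutes_in_image[OF assms] by blast
  then show "continuous_map (product_topology (\<lambda>_. S) {..<g}) S (\<lambda>f. (f \<circ> \<sigma>) k)"
    unfolding comp_apply by (rule continuous_map_product_projection)
qed

text \<open>The preimage of the image of a closed \<open>C\<close> is the union of its translates
  under permuting coordinates. These are finitely many closed sets, and the quotient topology tests
  closedness on preimages.\<close>

lemma closed_map_sym_proj:
  "closed_map (product_topology (\<lambda>_. S) {..<g}) (sym_product g S) (sym_proj g)"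
  unfolding closed_map_def
proof (intro allI impI)
  let ?P = "product_topology (\<lambda>_. S) {..<g}"
  fix C assume C: "closedin ?P C"
  have "{f \<in> topspace ?P. sym_proj g f \<in> sym_proj g ` C} =
      (\<Union>\<sigma>\<in>{\<sigma>. \<sigma> permutes {..<g}}. {f \<in> topspace ?P. f \<circ> \<sigma> \<in> C})"
  proof (intro equalityI subsetI)
    fix f assume "f \<in> {f \<in> topspace ?P. sym_proj g f \<in> sym_proj g ` C}"
    then obtain h where "f \<in> topspace ?P" "h \<in> C" "sym_proj g f = sym_proj g h" by blast
    then show "f \<in> (\<Union>\<sigma>\<in>{\<sigma>. \<sigma> permutes {..<g}}. {f \<in> topspace ?P. f \<circ> \<sigma> \<in> C})"
      unfolding sym_proj_eq_iff by blast
  next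
    fix f assume "f \<in> (\<Union>\<sigma>\<in>{\<sigma>. \<sigma> permutes {..<g}}. {f \<in> topspace ?P. f \<circ> \<sigma> \<in> C})"
    then obtain \<sigma> where "f \<in> topspace ?P" "\<sigma> permutes {..<g}" "f \<circ> \<sigma> \<in> C" by blast
    moreover from this have "sym_proj g f = sym_proj g (f \<circ> \<sigma>)"
      unfolding sym_proj_eq_iff by blast
    ultimately show "f \<in> {f \<in> topspace ?P. sym_proj g f \<in> sym_proj g ` C}" by simp
  qed
  also have "closedin ?P \<dots>"
  proof (rule closedin_Union)
    show "finite ((\<lambda>\<sigma>. {f \<in> topspace ?P. f \<circ> \<sigma> \<in> C}) ` {\<sigma>. \<sigma> permutes {..<g}})"
      by (simp add: finite_permutations)
    fix D assume "D \<in> (\<lambda>\<sigma>. {f \<in> topspace ?P. f \<circ> \<sigma> \<in> C}) ` {\<sigma>. \<sigma> permutes {..<g}}"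
    then obtain \<sigma> where "\<sigma> permutes {..<g}" and D: "D = {f \<in> topspace ?P. f \<circ> \<sigma> \<in> C}" by blast
    then show "closedin ?P D"
      unfolding D by (intro closedin_continuous_map_preimage[OF _ C] continuous_map_permute_coordinates)
  qed
  finally have "closedin ?P {f \<in> topspace ?P. sym_proj g f \<in> sym_proj g ` C}" .
  moreover have "sym_proj g ` C \<subseteq> topspace (sym_product g S)"
    unfolding topspace_sym_product using closedin_subset[OF C] by (rule image_mono)
  ultimately show "closedin (sym_product g S) (sym_proj g ` C)"
    using quotient_map_sym_proj[of S g] unfolding quotient_map_closedin by blast
qed

section \<open>The tori as embedded compact spaces\<close>

text \<open>The coordinatewise map from the compact torus to the Hausdorff product is closed, and so
  is \<open>sym_proj\<close>. Their composite is a continuous closed injection, hence an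
  embedding.\<close>

lemma embedding_map_torus_map:
  assumes \<gamma>: "attaching_loops g S \<gamma>" and S: "Hausdorff_space S"
  shows "embedding_map (torus g) (sym_product g S) (torus_map g \<gamma>)"
proof -
  let ?P = "product_topology (\<lambda>_. S) {..<g}"
  let ?f = "\<lambda>\<theta>. \<lambda>i\<in>{..<g}. \<gamma> i (\<theta> i)"
  have comp: "torus_map g \<gamma> = sym_proj g \<circ> ?f"
    by (auto simp: torus_map_def)
  have f: "continuous_map (torus g) ?P ?f"
    unfolding continuous_map_componentwise
  proof (intro conjI ballI)
    fix k assume k: "k \<in> {..<g}"
    then have "continuous_map circle S (\<gamma> k)"
      using \<gamma> unfolding attaching_loops_def embedding_map_def
      by (meson homeomorphic_imp_continuous_map continuous_map_into_fulltopology lessThan_iff)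
    then have "continuous_map (torus g) S (\<gamma> k \<circ> (\<lambda>\<theta>. \<theta> k))"
      unfolding torus_def
      by (rule continuous_map_compose[OF continuous_map_product_projection[OF k]])
    then show "continuous_map (torus g) S (\<lambda>\<theta>. ?f \<theta> k)"
      using k by (simp add: o_def)
  qed auto
  have "compact_space (torus g)"
    unfolding torus_def by (simp add: compact_space_product_topology compact_space_subtopology)
  moreover have "Hausdorff_space ?P"
    using S by (simp add: Hausdorff_space_product_topology)
  ultimately have "closed_map (torus g) ?P ?f"
    using f T1_Spaces.continuous_imp_closed_map by blast
  then have "closed_map (torus g) (sym_product g S) (torus_map g \<gamma>)"
    unfolding comp using closed_map_sym_proj by (rule closed_map_compose)
  moreover have "continuous_map (torus g) (sym_product g S) (torus_map g \<gamma>)"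
    unfolding comp using f quotient_imp_continuous_map[OF quotient_map_sym_proj]
    by (rule continuous_map_compose)
  ultimately show ?thesis
    using torus_map_inj[OF \<gamma>] by (intro injective_closed_imp_embedding_map)
qed

lemma torus_map_inv:
  assumes "w \<in> sym_torus g \<gamma>"
  shows "torus_map_inv g \<gamma> w \<in> topspace (torus g)" "torus_map g \<gamma> (torus_map_inv g \<gamma> w) = w"
  using assms unfolding torus_map_inv_def torus_map_image[symmetric]
  by (fact inv_into_into, fact f_inv_into_f)

text \<open>The inverse \<open>h\<close> of the homeomorphism onto the image is continuous, and it
  agrees with the chosen preimage \<open>torus_map_inv\<close> along \<open>c\<close>. Thus the
  boundary arcs of a disk become paths in the torus.\<close>

lemma path_in_sym_torus:
  assumes \<gamma>: "attaching_loops g S \<gamma>" and S: "Hausdorff_space S"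
    and c: "pathin (sym_product g S) c" "c \<in> {0..1} \<rightarrow> sym_torus g \<gamma>"
  shows "pathin (torus g) (\<lambda>t. torus_map_inv g \<gamma> (c t))"
proof -
  have "homeomorphic_map (torus g) (subtopology (sym_product g S) (sym_torus g \<gamma>)) (torus_map g \<gamma>)"
    using embedding_map_torus_map[OF \<gamma> S] unfolding embedding_map_def torus_map_image .
  then obtain h where h: "homeomorphic_maps (torus g) (subtopology (sym_product g S) (sym_torus g \<gamma>)) (torus_map g \<gamma>) h"
    unfolding homeomorphic_map_maps by blast
  have "pathin (subtopology (sym_product g S) (sym_torus g \<gamma>)) c"
    using c by (auto simp: pathin_subtopology)
  then have "pathin (torus g) (h \<circ> c)"
    using h pathin_compose unfolding homeomorphic_maps_def by blast
  moreover have "(h \<circ> c) t = torus_map_inv g \<gamma> (c t)" if "t \<in> {0..1}" for t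
    using h that c(2) torus_map_inv unfolding homeomorphic_maps_def
    by (metis Pi_mem comp_apply)
  ultimately show ?thesis
    unfolding pathin_def by (rule continuous_map_eq) simp
qed

lemma continuous_map_torus_map:
  assumes "attaching_loops g S \<gamma>" "Hausdorff_space S"
  shows "continuous_map (torus g) (sym_product g S) (torus_map g \<gamma>)"
  using embedding_map_torus_map[OF assms] unfolding embedding_map_def
  by (meson homeomorphic_imp_continuous_map continuous_map_into_fulltopology)

section \<open>Whitney disks and common value classes\<close>

text \<open>The loop \<open>c\<close> followed by \<open>d\<close> backwards contracts in
  \<open>Y'\<close>. The contraction is a square with this loop on one side; it is reparametrized by
  the disk and projected by \<open>pY\<close>.\<close>

lemma whitney_disk_if_same_end_lifts:
  assumes p: "continuous_map Y' (sym_product g S) pY" and Y': "simply_connected_space Y'"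
    and c: "pathin Y' c" "\<And>t. t \<in> {0..1} \<Longrightarrow> pY (c t) \<in> sym_torus g \<alpha>"
    and d: "pathin Y' d" "\<And>t. t \<in> {0..1} \<Longrightarrow> pY (d t) \<in> sym_torus g \<beta>"
    and cd: "c 0 = d 0" "c 1 = d 1"
  shows "\<exists>u. whitney_disk g S \<alpha> \<beta> (pY (c 0)) (pY (c 1)) u"
proof -
  define l where "l t = (if t \<le> 1 / 2 then c (2 * t) else d (2 - 2 * t))" for t :: real
  have l: "pathin Y' l"
    unfolding l_def by (rule pathin_join_reversed[OF c(1) d(1) cd(2)])
  have l01: "l 0 = c 0" "l 1 = c 0" "l (1 / 2) = c 1"
    using cd by (auto simp: l_def)
  then obtain H :: "real \<times> real \<Rightarrow> _" where H: "continuous_map (top_of_set ({0..1} \<times> {0..1})) Y' H"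
    "\<forall>t. H (0, t) = l t \<and> H (1, t) = c 0" "\<forall>s\<in>{0..1}. H (s, 0) = c 0 \<and> H (s, 1) = c 0"
    using simply_connected_space_loop_square[OF Y' l] by auto
  txt \<open>\<open>H\<close> is constant on three sides of the square, so no homeomorphism with the disk is needed:
    it suffices to clamp, with \<open>\<i>\<close> landing on the midpoint of the fourth side \<open>s = 0\<close>. The unit circle
    goes to the boundary of the square because one of \<open>\<bar>Re z\<bar>\<close>, \<open>\<bar>Im z\<bar>\<close> is at least \<open>1/2\<close> on it.\<close>
  define k where "k r = max 0 (min 1 (1 / 2 - r))" for r :: real
  define q where "q z = (k (Im z), k (Re z))" for z
  define u where "u = pY \<circ> (H \<circ> q)"
  have "continuous_on (cball 0 1) q"
    unfolding q_def k_def by (intro continuous_intros)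
  moreover have "q z \<in> {0..1} \<times> {0..1}" for z
    by (auto simp: q_def k_def)
  ultimately have "continuous_map (top_of_set (cball 0 1)) (top_of_set ({0..1} \<times> {0..1})) q"
    by auto
  then have "continuous_map (top_of_set (cball 0 1)) (sym_product g S) u"
    unfolding u_def using H(1) p by (intro continuous_map_compose)
  moreover have side: "u z \<in> {pY (c 0), pY (l (k (Re z)))}" if "z \<in> sphere 0 1" for z
  proof -
    have "(Re z)\<^sup>2 + (Im z)\<^sup>2 = 1"
      using that by (simp add: cmod_def)
    then have "\<not> (\<bar>Re z\<bar> < 1 / 2 \<and> \<bar>Im z\<bar> < 1 / 2)"
      using abs_square_less_1 power_strict_mono[of "\<bar>Re z\<bar>" "1 / 2" 2] power_strict_mono[of "\<bar>Im z\<bar>" "1 / 2" 2]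
      by (auto simp: power2_eq_square)
    then consider "k (Re z) = 0" | "k (Re z) = 1" | "k (Im z) = 0" | "k (Im z) = 1"
      unfolding k_def by linarith
    then show ?thesis
      using H(2,3) by cases (auto simp: u_def q_def k_def)
  qed
  \<comment> \<open>\<open>k\<close> is nonincreasing with \<open>k 0 = 1 / 2\<close>, so
    \<open>Re z \<ge> 0\<close> selects the first half of \<open>l\<close>, which is
    \<open>c\<close>. The constant sides contribute \<open>pY (c 0)\<close>, which lies in the same
    torus.\<close>
  moreover have "u z \<in> sym_torus g \<alpha>" if "z \<in> sphere 0 1" "Re z \<ge> 0" for z
  proof -
    have "0 \<le> k (Re z)" "k (Re z) \<le> 1 / 2"
      using that(2) unfolding k_def by linarith+
    then have "l (k (Re z)) = c (2 * k (Re z))" "2 * k (Re z) \<in> {0..1}"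
      by (simp_all add: l_def)
    then show ?thesis
      using side[OF that(1)] c(2)[of 0] c(2)[of "2 * k (Re z)"] by auto
  qed
  moreover have "u z \<in> sym_torus g \<beta>" if "z \<in> sphere 0 1" "Re z \<le> 0" for z
  proof -
    have k: "1 / 2 \<le> k (Re z)" "k (Re z) \<le> 1"
      using that(2) unfolding k_def by linarith+
    then have "2 - 2 * k (Re z) \<in> {0..1}"
      by simp
    moreover have "l (k (Re z)) = d (2 - 2 * k (Re z))"
    \<comment> \<open>At time \<open>1 / 2\<close> the definition of \<open>l\<close> takes the
      branch of \<open>c\<close>, so \<open>c 1 = d 1\<close> is used there.\<close>
    proof (cases "k (Re z) = 1 / 2")
      case True
      then show ?thesis
        unfolding True using cd(2) by (simp add: l_def)
    qed (use k(1) in \<open>simp add: l_def\<close>)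
    ultimately show ?thesis
      using side[OF that(1)] cd(1) d(2)[of 0] d(2)[of "2 - 2 * k (Re z)"] by auto
  qed
  \<comment> \<open>\<open>q\<close> sends \<open>- \<i>\<close> to the side \<open>s = 1\<close>,
    where \<open>H\<close> is constantly \<open>c 0\<close>, and \<open>\<i>\<close> to
    \<open>(0, 1 / 2)\<close>, where \<open>H\<close> is \<open>l (1 / 2) = c 1\<close>.\<close>
  moreover have "u (- \<i>) = pY (c 0)" "u \<i> = pY (c 1)"
    using H(2) l01 by (auto simp: u_def q_def k_def)
  ultimately show ?thesis
    unfolding whitney_disk_def by (intro exI[of _ u]) auto
qed

text \<open>Sweeping the disk from its right arc to its left arc is a homotopy from \<open>c\<close>
  to \<open>d\<close> with fixed ends, so \<open>lift_homotopic_paths_endpoint\<close> applies. The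
  last claim allows arbitrary lifts because the theorem supplies liftings composed with paths in
  \<open>X'\<close>.\<close>

lemma whitney_disk_lifts_same_end:
  assumes u: "whitney_disk g S \<alpha> \<beta> x y u" and cov: "covering_map Y' (sym_product g S) pY"
    and c_def: "c = (\<lambda>t. u (Complex (sin (pi * t)) (- cos (pi * t))))"
    and d_def: "d = (\<lambda>t. u (Complex (- sin (pi * t)) (- cos (pi * t))))"
  shows "pathin (sym_product g S) c" "c \<in> {0..1} \<rightarrow> sym_torus g \<alpha>" "c 0 = x" "c 1 = y"
    and "pathin (sym_product g S) d" "d \<in> {0..1} \<rightarrow> sym_torus g \<beta>" "d 0 = x" "d 1 = y"
    and "\<lbrakk>pathin Y' c'; \<And>t. t \<in> {0..1} \<Longrightarrow> pY (c' t) = c t;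
          pathin Y' d'; \<And>t. t \<in> {0..1} \<Longrightarrow> pY (d' t) = d t; c' 0 = d' 0\<rbrakk> \<Longrightarrow> c' 1 = d' 1"
proof -
  have uc: "continuous_map (top_of_set (cball 0 1)) (sym_product g S) u"
    and ua: "\<And>z. norm z = 1 \<Longrightarrow> Re z \<ge> 0 \<Longrightarrow> u z \<in> sym_torus g \<alpha>"
    and ub: "\<And>z. norm z = 1 \<Longrightarrow> Re z \<le> 0 \<Longrightarrow> u z \<in> sym_torus g \<beta>"
    and ux: "u (- \<i>) = x" "u \<i> = y"
    using u unfolding whitney_disk_def by auto
  have poles: "Complex 0 (-1) = - \<i>" "Complex 0 1 = \<i>"
    by (auto simp: complex_eq_iff)
  \<comment> \<open>For fixed \<open>t\<close> this runs along the horizontal chord at height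
    \<open>- cos (pi * t)\<close>, from the right arc at \<open>s = 0\<close> to the left arc at
    \<open>s = 1\<close>. At \<open>t = 0\<close> and \<open>t = 1\<close> the chord shrinks to
    \<open>- \<i>\<close> and \<open>\<i>\<close>.\<close>
  define h where "h = (\<lambda>(s, t). Complex ((1 - 2 * s) * sin (pi * t)) (- cos (pi * t)))"
  define H where "H = u \<circ> h"
  have "norm (h (s, t)) \<le> 1" if "s \<in> {0..1}" for s t
  proof -
    have "\<bar>1 - 2 * s\<bar> \<le> 1" using that by auto
    then have "(1 - 2 * s)\<^sup>2 * (sin (pi * t))\<^sup>2 \<le> 1 * (sin (pi * t))\<^sup>2"
      by (intro mult_right_mono) (auto simp: abs_square_le_1)
    then have "(1 - 2 * s)\<^sup>2 * (sin (pi * t))\<^sup>2 + (cos (pi * t))\<^sup>2 \<le> 1"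
      using sin_cos_squared_add[of "pi * t"] by linarith
    then show ?thesis
      by (simp add: h_def cmod_def power_mult_distrib)
  qed
  moreover have "continuous_on ({0..1} \<times> {0..1}) h"
    unfolding h_def Complex_eq case_prod_unfold by (intro continuous_intros)
  ultimately have "continuous_map (top_of_set ({0..1} \<times> {0..1})) (top_of_set (cball 0 1)) h"
    by auto
  then have H: "continuous_map (top_of_set ({0..1} \<times> {0..1})) (sym_product g S) H"
    unfolding H_def using uc by (rule continuous_map_compose)
  have Hcd: "H (0, t) = c t" "H (1, t) = d t" for t
    by (auto simp: H_def h_def c_def d_def)
  have H01: "H (s, 0) = x" "H (s, 1) = y" for s
    using ux by (auto simp: H_def h_def poles)
  have norm: "norm (Complex (sin r) (- cos r)) = 1" "norm (Complex (- sin r) (- cos r)) = 1" for r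
    by (simp_all add: cmod_def)
  have sin: "sin (pi * t) \<ge> 0" if "t \<in> {0..1}" for t
    using that by (intro sin_ge_zero) (auto simp: mult_left_le)
  have "pathin (sym_product g S) (\<lambda>t. H (r, t))" if "r \<in> {0..1}" for r
    using that by (intro pathin_square[OF H]) (auto intro: continuous_intros)
  from this[of 0] this[of 1] show "pathin (sym_product g S) c" "pathin (sym_product g S) d"
    by (simp_all add: Hcd)
  show "c \<in> {0..1} \<rightarrow> sym_torus g \<alpha>"
    unfolding c_def using sin norm by (auto intro!: ua)
  show "d \<in> {0..1} \<rightarrow> sym_torus g \<beta>"
    unfolding d_def using sin norm by (auto intro!: ub)
  show "c 0 = x" "c 1 = y" "d 0 = x" "d 1 = y"
    using H01 by (simp_all flip: Hcd)
  assume lifts: "pathin Y' c'" "\<And>t. t \<in> {0..1} \<Longrightarrow> pY (c' t) = c t"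
    "pathin Y' d'" "\<And>t. t \<in> {0..1} \<Longrightarrow> pY (d' t) = d t" "c' 0 = d' 0"
  show "c' 1 = d' 1"
    by (rule lift_homotopic_paths_endpoint[OF cov H _ _ lifts(1) _ lifts(3)]) (use lifts Hcd H01 in auto)
qed

theorem theorem4p1:
  fixes g :: nat
    and S :: "'a topology" and \<mu> :: "'a \<Rightarrow> 'a chain set"
    and \<alpha> \<beta> :: "nat \<Rightarrow> complex \<Rightarrow> 'a"
    and X' :: "'c topology" and pX :: "'c \<Rightarrow> nat \<Rightarrow> complex"
    and Y' :: "'d topology" and pY :: "'d \<Rightarrow> (nat \<Rightarrow> 'a) set"
    and x y :: "(nat \<Rightarrow> 'a) set"
  assumes "heegaard_diagram g S \<mu> \<alpha> \<beta>"
    and "universal_covering X' (torus g) pX"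
    and "universal_covering Y' (sym_product g S) pY"
    and "x \<in> sym_torus g \<alpha> \<inter> sym_torus g \<beta>"
    and "y \<in> sym_torus g \<alpha> \<inter> sym_torus g \<beta>"
  shows "(\<exists>u. whitney_disk g S \<alpha> \<beta> x y u) \<longleftrightarrow>
         same_common_value_class X' pX Y' pY (torus_map g \<alpha>) (torus_map g \<beta>)
           (torus_map_inv g \<alpha> x, torus_map_inv g \<beta> x)
           (torus_map_inv g \<alpha> y, torus_map_inv g \<beta> y)"
proof
  have loops: "attaching_loops g S \<alpha>" "attaching_loops g S \<beta>" and S: "Hausdorff_space S"
    using assms(1) unfolding heegaard_diagram_def closed_oriented_surface_def closed_surface_def by auto
  have X': "covering_map X' (torus g) pX" "simply_connected_space X'"
    and Y': "covering_map Y' (sym_product g S) pY" "simply_connected_space Y'"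
    using assms(2,3) unfolding universal_covering_def by auto
  have pX: "continuous_map X' (torus g) pX" and pY: "continuous_map Y' (sym_product g S) pY"
    using X' Y' covering_map_continuous by blast+
  have lpc: "locally_path_connected_space X'"
    using X'(1) locally_path_connected_space_torus by (rule covering_map_locally_path_connected)
  {
    assume "\<exists>u. whitney_disk g S \<alpha> \<beta> x y u"
    then obtain u where u: "whitney_disk g S \<alpha> \<beta> x y u" by blast
    define c d where "c = (\<lambda>t. u (Complex (sin (pi * t)) (- cos (pi * t))))"
      and "d = (\<lambda>t. u (Complex (- sin (pi * t)) (- cos (pi * t))))"
    note c = whitney_disk_lifts_same_end(1-4)[OF u Y'(1) c_def d_def]
      and d = whitney_disk_lifts_same_end(5-8)[OF u Y'(1) c_def d_def]
      and same_end = whitney_disk_lifts_same_end(9)[OF u Y'(1) c_def d_def]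
    \<comment> \<open>The path \<open>w\<close> is pulled back to the torus and lifted to
      \<open>a\<close>; the lifting \<open>\<phi>\<close> of the torus map is then normalized at
      \<open>a 0\<close>. Using the same \<open>e\<close> for both tori makes the two liftings agree
      at the start.\<close>
    have lift: "\<exists>\<phi> a. is_lifting X' pX Y' pY (torus_map g \<gamma>) \<phi> \<and> pathin X' a \<and>
        (\<forall>t\<in>{0..1}. pX (a t) = torus_map_inv g \<gamma> (w t)) \<and> \<phi> (a 0) = e"
      if \<gamma>: "attaching_loops g S \<gamma>" and w: "pathin (sym_product g S) w" "w \<in> {0..1} \<rightarrow> sym_torus g \<gamma>"
        and e: "e \<in> topspace Y'" "pY e = w 0" for \<gamma> w e
    proof -
      have path: "pathin (torus g) (\<lambda>t. torus_map_inv g \<gamma> (w t))"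
        using path_in_sym_torus[OF \<gamma> S w] .
      have w0: "w 0 \<in> sym_torus g \<gamma>"
        using w(2) by auto
      obtain a0 where a0: "a0 \<in> topspace X'" "pX a0 = torus_map_inv g \<gamma> (w 0)"
        using X'(1) torus_map_inv(1)[OF w0] unfolding covering_map_def by (metis imageE)
      obtain a where a: "pathin X' a" "\<forall>t\<in>{0..1}. pX (a t) = torus_map_inv g \<gamma> (w t)" "a 0 = a0"
        using covering_map_lift_path[OF X'(1) path a0] by blast
      have f: "continuous_map X' (sym_product g S) (torus_map g \<gamma> \<circ> pX)"
        using pX continuous_map_torus_map[OF \<gamma> S] by (rule continuous_map_compose)
      have "pY e = (torus_map g \<gamma> \<circ> pX) a0"
        using e(2) a0(2) torus_map_inv(2)[OF w0] by simp
      then obtain \<phi> where "continuous_map X' Y' \<phi>"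
        "\<forall>z\<in>topspace X'. pY (\<phi> z) = (torus_map g \<gamma> \<circ> pX) z" "\<phi> a0 = e"
        using covering_map_lift[OF Y'(1) X'(2) lpc f a0(1) e(1)] by blast
      then show ?thesis
        using a unfolding is_lifting_def comp_apply by blast
    qed
    have "x \<in> topspace (sym_product g S)"
      using path_start_in_topspace[OF c(1)] c(3) by simp
    then obtain e where e: "e \<in> topspace Y'" "pY e = x"
      using Y'(1) unfolding covering_map_def by (metis imageE)
    obtain \<phi> a where a: "is_lifting X' pX Y' pY (torus_map g \<alpha>) \<phi>" "pathin X' a"
        "\<forall>t\<in>{0..1}. pX (a t) = torus_map_inv g \<alpha> (c t)" "\<phi> (a 0) = e"
      using lift[OF loops(1) c(1,2) e(1)] e(2) c(3) by blast
    obtain \<psi> b where b: "is_lifting X' pX Y' pY (torus_map g \<beta>) \<psi>" "pathin X' b"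
        "\<forall>t\<in>{0..1}. pX (b t) = torus_map_inv g \<beta> (d t)" "\<psi> (b 0) = e"
      using lift[OF loops(2) d(1,2) e(1)] e(2) d(3) by blast
    have in_top: "q t \<in> topspace X'" if "pathin X' q" "t \<in> {0..1}" for q t
      using that unfolding pathin_def continuous_map_def by auto
    \<comment> \<open>Both composites start at \<open>e\<close> and lift the two boundary arcs, so
      the disk forces their ends to coincide.\<close>
    have "(\<phi> \<circ> a) 1 = (\<psi> \<circ> b) 1"
    proof (rule same_end)
      show "pathin Y' (\<phi> \<circ> a)" "pathin Y' (\<psi> \<circ> b)"
        using a b pathin_compose unfolding is_lifting_def by blast+
      show "pY ((\<phi> \<circ> a) t) = c t" if "t \<in> {0..1}" for t
        using a in_top[OF a(2) that] that c(2) torus_map_inv(2) unfolding is_lifting_def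
        by (metis Pi_mem comp_apply)
      show "pY ((\<psi> \<circ> b) t) = d t" if "t \<in> {0..1}" for t
        using b in_top[OF b(2) that] that d(2) torus_map_inv(2) unfolding is_lifting_def
        by (metis Pi_mem comp_apply)
    qed (use a b in simp)
    \<comment> \<open>Time 0 accounts for \<open>x\<close> and time 1 for \<open>y\<close>, with one
      and the same pair of liftings.\<close>
    then have "(a t, b t) \<in> CVP X' \<phi> \<psi>" if "t \<in> {0, 1}" for t
      using that a(4) b(4) in_top[OF a(2)] in_top[OF b(2)] unfolding CVP_def by auto
    then have "(pX (a t), pX (b t)) \<in> common_value_class X' pX \<phi> \<psi>" if "t \<in> {0, 1}" for t
      using that unfolding common_value_class_def by (metis imageI map_prod_simp)
    from this[of 0] this[of 1]
    have "(torus_map_inv g \<alpha> x, torus_map_inv g \<beta> x) \<in> common_value_class X' pX \<phi> \<psi>"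
      "(torus_map_inv g \<alpha> y, torus_map_inv g \<beta> y) \<in> common_value_class X' pX \<phi> \<psi>"
      using a(3) b(3) c(3,4) d(3,4) by auto
    then show "same_common_value_class X' pX Y' pY (torus_map g \<alpha>) (torus_map g \<beta>)
           (torus_map_inv g \<alpha> x, torus_map_inv g \<beta> x)
           (torus_map_inv g \<alpha> y, torus_map_inv g \<beta> y)"
      unfolding same_common_value_class_def using a(1) b(1) by blast
  }
  {
    assume "same_common_value_class X' pX Y' pY (torus_map g \<alpha>) (torus_map g \<beta>)
           (torus_map_inv g \<alpha> x, torus_map_inv g \<beta> x)
           (torus_map_inv g \<alpha> y, torus_map_inv g \<beta> y)"
    then obtain \<phi> \<psi> where \<phi>: "is_lifting X' pX Y' pY (torus_map g \<alpha>) \<phi>"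
      and \<psi>: "is_lifting X' pX Y' pY (torus_map g \<beta>) \<psi>"
      and cvc: "(torus_map_inv g \<alpha> x, torus_map_inv g \<beta> x) \<in> common_value_class X' pX \<phi> \<psi>"
        "(torus_map_inv g \<alpha> y, torus_map_inv g \<beta> y) \<in> common_value_class X' pX \<phi> \<psi>"
      unfolding same_common_value_class_def by blast
    have pair: "\<exists>a b. a \<in> topspace X' \<and> b \<in> topspace X' \<and> \<phi> a = \<psi> b \<and> pX a = v \<and> pX b = w"
      if "(v, w) \<in> common_value_class X' pX \<phi> \<psi>" for v w
      using that unfolding common_value_class_def CVP_def by auto
    obtain a0 b0 where 0: "a0 \<in> topspace X'" "b0 \<in> topspace X'" "\<phi> a0 = \<psi> b0"
      "pX a0 = torus_map_inv g \<alpha> x"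
      using pair[OF cvc(1)] by blast
    obtain a1 b1 where 1: "a1 \<in> topspace X'" "b1 \<in> topspace X'" "\<phi> a1 = \<psi> b1"
      "pX a1 = torus_map_inv g \<alpha> y"
      using pair[OF cvc(2)] by blast
    \<comment> \<open>Since \<open>\<phi>\<close> and \<open>\<psi>\<close> agree at both pairs of
      ends, \<open>\<phi> \<circ> a\<close> and \<open>\<psi> \<circ> b\<close> share their
      endpoints in \<open>Y'\<close>, whichever paths \<open>a\<close> and \<open>b\<close> are
      chosen.\<close>
    obtain a where a: "pathin X' a" "a 0 = a0" "a 1 = a1"
      using X'(2) 0(1) 1(1) unfolding simply_connected_space_def path_connected_space_def by blast
    obtain b where b: "pathin X' b" "b 0 = b0" "b 1 = b1"
      using X'(2) 0(2) 1(2) unfolding simply_connected_space_def path_connected_space_def by blast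
    have torus: "pY ((\<xi> \<circ> q) t) \<in> sym_torus g \<gamma>"
      if \<xi>: "is_lifting X' pX Y' pY (torus_map g \<gamma>) \<xi>" and q: "pathin X' q" and t: "t \<in> {0..1}" for \<xi> q t \<gamma>
    proof -
      have "q t \<in> topspace X'"
        using q t unfolding pathin_def continuous_map_def by auto
      then have "pY (\<xi> (q t)) = torus_map g \<gamma> (pX (q t))" "pX (q t) \<in> topspace (torus g)"
        using \<xi> pX unfolding is_lifting_def continuous_map_def by auto
      then show ?thesis
        unfolding torus_map_image[symmetric] by simp
    qed
    have "\<exists>u. whitney_disk g S \<alpha> \<beta> (pY ((\<phi> \<circ> a) 0)) (pY ((\<phi> \<circ> a) 1)) u"
    proof (rule whitney_disk_if_same_end_lifts[OF pY Y'(2), where d = "\<psi> \<circ> b"])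
      show "pathin Y' (\<phi> \<circ> a)" "pathin Y' (\<psi> \<circ> b)"
        using a b \<phi> \<psi> pathin_compose unfolding is_lifting_def by blast+
    qed (use a b 0 1 torus \<phi> \<psi> in auto)
    moreover have "pY (\<phi> a0) = x" "pY (\<phi> a1) = y"
      using \<phi> 0 1 assms(4,5) torus_map_inv(2)[of _ g \<alpha>] unfolding is_lifting_def by auto
    ultimately show "\<exists>u. whitney_disk g S \<alpha> \<beta> x y u"
      using a by simp
  }
qed

end
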